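(* Let $s\in(0,1)$, $p\in(1,\infty)$, $w\in A_p$, let $B\subset\mathbb{R}^n$ be a ball of radius $r$ and let $v\in W^{s,p}_w(B)$. Then $$\int_B|v-\langle v\rangle_B|^p\,w(x)\,dx\le C\,(1-s)\,r^{sp}\int_B\int_B\frac{|v(x)-v(y)|^p}{|x-y|^{sp}}\frac{w(x)w(y)}{w(B_{x,y})}\,dx\,dy,$$ where $\langle v\rangle_B=\frac1{|B|}\int_B v\,dx$ and $C$ depends continuously on $n$, $p$ and $[w]_{A_p}$ (and on nothing else). Moreover, the mean value $\langle v\rangle_B$ on the left-hand side can be replaced by $\langle v\rangle_\psi:=\int_B v\,\psi\,dx$, where either $\psi=\frac{w}{w(B)}$, or $\psi\in L^\infty(B)$ satisfies $\int_B\psi\,dx=1$ and $\|\psi\|_{L^\infty(B)}\le \frac{c_0}{|B|}$ (in the latter case $C$ depends also on $c_0$).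
   Context: Throughout $n\ge2$. A weight is a function $w\in L^1_{\mathrm{loc}}(\mathbb{R}^n)$ with $w>0$ a.e.; $w(U)=\int_U w\,dx$. For $1<p<\infty$, $w\in A_p$ means $$[w]_{A_p}:=\sup_{B}\Big(\frac1{|B|}\int_B w\,dx\Big)\Big(\frac1{|B|}\int_B w^{\frac1{1-p}}dx\Big)^{p-1}<\infty,$$ the supremum being over all balls in $\mathbb{R}^n$. For $x,y\in\mathbb{R}^n$ let $B_{x,y}$ be the ball with center $\frac{x+y}2$ and radius $\frac12|x-y|$. For open bounded $\Omega\subset\mathbb{R}^n$, $$W^{s,p}_w(\Omega)=\Big\{v\in L^p(\Omega):\int_\Omega\int_\Omega\frac{|v(x)-v(y)|^p}{|x-y|^{sp}}\frac{w(x)w(y)}{w(B_{x,y})}\,dx\,dy<\infty\Big\}.$$ *)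

theory Defs
  imports "HOL-Analysis.Analysis" "HOL-Probability.Essential_Supremum"
begin

text \<open>All integrals are with respect to the (complete) Lebesgue measure; functions given only on
  a set are functions on the whole space of which only the restriction to that set matters.\<close>

definition weight :: "(real ^ 'n \<Rightarrow> real) \<Rightarrow> bool" where
  "weight w \<longleftrightarrow> (\<forall>K. compact K \<longrightarrow> integrable (lebesgue_on K) w) \<and> (AE x in lebesgue. w x > 0)"

definition weight_measure :: "(real ^ 'n \<Rightarrow> real) \<Rightarrow> (real ^ 'n) set \<Rightarrow> real" where
  "weight_measure w U = integral\<^sup>L (lebesgue_on U) w"

text \<open>Extended powers, meant for exponents \<open>a > 0\<close>.\<close>

definition ennreal_powr :: "ennreal \<Rightarrow> real \<Rightarrow> ennreal" where
  "ennreal_powr x a = (if x = \<infinity> then \<infinity> else ennreal (enn2real x powr a))"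

definition nn_average :: "(real ^ 'n) set \<Rightarrow> (real ^ 'n \<Rightarrow> real) \<Rightarrow> ennreal" where
  "nn_average U f = (\<integral>\<^sup>+ x. ennreal (f x) \<partial>lebesgue_on U) / emeasure lebesgue U"

text \<open>The supremum is formed in the extended reals, so that it is infinite if
  \<open>w\<^bsup>1/(1-p)\<^esup>\<close> fails to be integrable on some ball.\<close>

definition Ap_const :: "real \<Rightarrow> (real ^ 'n \<Rightarrow> real) \<Rightarrow> ennreal" where
  "Ap_const p w =
     (SUP (z, \<rho>) \<in> UNIV \<times> {0<..}.
        nn_average (ball z \<rho>) w *
        ennreal_powr (nn_average (ball z \<rho>) (\<lambda>x. w x powr (1 / (1 - p)))) (p - 1))"

definition Ap_class :: "real \<Rightarrow> (real ^ 'n \<Rightarrow> real) set" where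
  "Ap_class p = {w. weight w \<and> Ap_const p w < \<infinity>}"

definition ball_between :: "real ^ 'n \<Rightarrow> real ^ 'n \<Rightarrow> (real ^ 'n) set" where
  "ball_between x y = ball ((1/2) *\<^sub>R (x + y)) (norm (x - y) / 2)"

text \<open>On the diagonal, which is a null set, the integrand is \<open>0\<close> since \<open>0 powr p = 0\<close>.\<close>

definition gagliardo ::
  "real \<Rightarrow> real \<Rightarrow> (real ^ 'n \<Rightarrow> real) \<Rightarrow> (real ^ 'n) set \<Rightarrow> (real ^ 'n \<Rightarrow> real) \<Rightarrow> ennreal" where
  "gagliardo s p w \<Omega> v =
     (\<integral>\<^sup>+ y. (\<integral>\<^sup>+ x.
        ennreal (\<bar>v x - v y\<bar> powr p / norm (x - y) powr (s * p)
                 * (w x * w y / weight_measure w (ball_between x y)))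
      \<partial>lebesgue_on \<Omega>) \<partial>lebesgue_on \<Omega>)"

definition Lp_space :: "real \<Rightarrow> (real ^ 'n) set \<Rightarrow> (real ^ 'n \<Rightarrow> real) set" where
  "Lp_space p \<Omega> = {v \<in> borel_measurable (lebesgue_on \<Omega>).
                      integrable (lebesgue_on \<Omega>) (\<lambda>x. \<bar>v x\<bar> powr p)}"

definition Linf_norm :: "(real ^ 'n) set \<Rightarrow> (real ^ 'n \<Rightarrow> real) \<Rightarrow> ereal" where
  "Linf_norm \<Omega> \<psi> = esssup (lebesgue_on \<Omega>) (\<lambda>x. ereal \<bar>\<psi> x\<bar>)"

definition Linf_space :: "(real ^ 'n) set \<Rightarrow> (real ^ 'n \<Rightarrow> real) set" where
  "Linf_space \<Omega> = {\<psi> \<in> borel_measurable (lebesgue_on \<Omega>). Linf_norm \<Omega> \<psi> < \<infinity>}"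

definition frac_sobolev ::
  "real \<Rightarrow> real \<Rightarrow> (real ^ 'n \<Rightarrow> real) \<Rightarrow> (real ^ 'n) set \<Rightarrow> (real ^ 'n \<Rightarrow> real) set" where
  "frac_sobolev s p w \<Omega> = {v \<in> Lp_space p \<Omega>. gagliardo s p w \<Omega> v < \<infinity>}"

definition mean :: "(real ^ 'n) set \<Rightarrow> (real ^ 'n \<Rightarrow> real) \<Rightarrow> real" where
  "mean B v = integral\<^sup>L (lebesgue_on B) v / measure lebesgue B"

definition psi_mean ::
  "(real ^ 'n) set \<Rightarrow> (real ^ 'n \<Rightarrow> real) \<Rightarrow> (real ^ 'n \<Rightarrow> real) \<Rightarrow> real" where
  "psi_mean B \<psi> v = integral\<^sup>L (lebesgue_on B) (\<lambda>x. v x * \<psi> x)"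

definition weighted_deviation ::
  "real \<Rightarrow> (real ^ 'n \<Rightarrow> real) \<Rightarrow> (real ^ 'n) set \<Rightarrow> (real ^ 'n \<Rightarrow> real) \<Rightarrow> real \<Rightarrow> ennreal" where
  "weighted_deviation p w B v m = (\<integral>\<^sup>+ x. ennreal (\<bar>v x - m\<bar> powr p * w x) \<partial>lebesgue_on B)"

end

theory Submission
  imports Defs
begin

text \<open>The proof rests on one inequality for each scale: with \<open>\<mu> = w dx\<close>, for every \<open>N \<ge> 1\<close>, the
  \<open>p\<close>-deviation of \<open>v\<close> from its mean over a ball \<open>B\<close> of radius \<open>r\<close> is at most \<open>C N\<^sup>p\<close> times the
  double integral of the Gagliardo kernel (without the singular factor \<open>|x - y|\<close> to the power
  \<open>- s p\<close>) over the pairs at distance less than \<open>4 r / N\<close> (\<open>deviation_le_truncated_energy\<close>). The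
  exponent of \<open>N\<close> has to be exactly \<open>p\<close>; it is what a Poincare inequality gives for a function
  regularised at scale \<open>r / N\<close>.

  To see this, let \<open>g z\<close> be, up to a dimensional factor, the mean of \<open>|v z - v y|\<close> over the \<open>y\<close> in
  \<open>B\<close> at distance less than \<open>4 r / N\<close> from \<open>z\<close>. Averaging the triangle inequality over a common
  neighbourhood gives \<open>|v z - v z'| \<le> g z + g z'\<close> whenever \<open>z\<close>, \<open>z'\<close> are at distance less than
  \<open>2 r / N\<close>, a bound that holds pointwise (\<open>diff_le_local_mean_osc\<close>). Walking from \<open>x\<close> to \<open>y\<close>
  along \<open>N\<close> equal steps of the segment and averaging over \<open>y\<close> bounds \<open>|v x - c|\<close>, where \<open>c\<close> is the
  mean of \<open>v\<close>, by a sum of \<open>2 N\<close> means of \<open>g\<close> over the balls \<open>x + t (B - x)\<close>, all contained in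
  \<open>B\<close>, the case \<open>t = 0\<close> being the value \<open>g x\<close> (\<open>abs_diff_mean_le\<close>). The \<open>A\<^sub>p\<close> condition makes each
  of these averaging operators bounded on \<open>L\<^sup>p(\<mu>)\<close> with a bound that does not depend on \<open>t\<close>
  (\<open>contracted_mean_bound\<close>), and applied once more it bounds the norm of \<open>g\<close> by the truncated
  double integral (\<open>local_mean_osc_bound\<close>).

  The factor \<open>1 - s\<close> then comes from summing over the dyadic scales \<open>N = 2\<^sup>k\<close>. The inequality at
  scale \<open>k\<close> is multiplied by \<open>b\<^sub>k\<close> and divided by \<open>N\<^sup>p\<close>, where \<open>b\<^sub>k\<close> is the increment of \<open>N\<close> to
  the power \<open>s p\<close> from the previous scale, with \<open>b\<^sub>0 = 1\<close>. On the right the increments telescope,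
  for each pair \<open>(x, y)\<close>, to at most \<open>4 r / |x - y|\<close> to the power \<open>s p\<close>; on the left they sum to
  at least a multiple of \<open>1 / (p (1 - s))\<close>, uniformly in \<open>s\<close> (\<open>fractional_poincare\<close>).

  For another mean \<open>m\<close> it suffices that \<open>|c - m|\<close>, as a constant function, has \<open>L\<^sup>p(\<mu>)\<close> norm
  controlled by the deviation from \<open>c\<close>: for the weighted mean by Hoelder's inequality, for a
  bounded density \<open>\<psi>\<close> by the \<open>A\<^sub>p\<close> condition. All of this is done for Borel functions and the
  Borel measure \<open>lborel\<close>; Lebesgue measurable data are replaced by Borel representatives at the
  end.\<close>

section \<open>Inequalities for powers\<close>

text \<open>Convexity of \<open>a \<mapsto> a\<^sup>p\<close>: the graph lies above its tangent at the point \<open>l\<close> times \<open>b\<close> to the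
  power \<open>1 / (p - 1)\<close>. The parameter \<open>l\<close> is left free so that it can be optimised after summation
  or integration, which yields the power mean and Hoelder inequalities below without treating
  vanishing integrals separately.\<close>

lemma young_tangent:
  fixes a b l p :: real
  assumes "1 < p" "0 \<le> a" "0 \<le> b" "0 \<le> l"
  shows "p * l powr (p - 1) * (a * b) \<le> a powr p + (p - 1) * l powr p * b powr (p / (p - 1))"
proof -
  have "a * (l powr (p - 1) * b) \<le> a powr p / p + (l powr (p - 1) * b) powr (p / (p - 1)) / (p / (p - 1))"
    using assms by (intro Youngs_inequality) (auto simp: field_simps)
  moreover have "(l powr (p - 1) * b) powr (p / (p - 1)) = l powr p * b powr (p / (p - 1))"
    using assms by (simp add: powr_mult powr_powr)
  ultimately have "p * (a * (l powr (p - 1) * b)) \<le> p * (a powr p / p + l powr p * b powr (p / (p - 1)) / (p / (p - 1)))"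
    using assms by (intro mult_left_mono) auto
  also have "\<dots> = a powr p + (p - 1) * (l powr p * b powr (p / (p - 1)))"
    using assms by (simp add: distrib_left)
  finally show ?thesis
    by (simp add: ac_simps)
qed

lemma sum_powr_le:
  fixes a :: "'i \<Rightarrow> real"
  assumes "finite I" "1 < p" "\<And>i. i \<in> I \<Longrightarrow> 0 \<le> a i"
  shows "(\<Sum>i\<in>I. a i) powr p \<le> real (card I) powr (p - 1) * (\<Sum>i\<in>I. a i powr p)"
proof (cases "I = {}")
  case False
  define m where "m = real (card I)"
  define S where "S = (\<Sum>i\<in>I. a i)"
  have m: "m > 0" using False assms by (simp add: m_def card_gt_0_iff)
  have S: "S \<ge> 0" unfolding S_def using assms by (simp add: sum_nonneg)
  have "(\<Sum>i\<in>I. p * (S / m) powr (p - 1) * a i) \<le> (\<Sum>i\<in>I. a i powr p + (p - 1) * (S / m) powr p)"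
    using young_tangent[of p "a _" 1 "S / m"] assms m S by (intro sum_mono) auto
  then have "p * (S / m) powr (p - 1) * S \<le> (\<Sum>i\<in>I. a i powr p) + m * ((p - 1) * (S / m) powr p)"
    by (simp add: sum.distrib S_def m_def flip: sum_distrib_left)
  moreover have "(S / m) powr (p - 1) * S = m * (S / m) powr p"
    using m S assms by (cases "S = 0") (auto simp: powr_diff powr_divide field_simps)
  ultimately have "p * (m * (S / m) powr p) \<le> (\<Sum>i\<in>I. a i powr p) + m * ((p - 1) * (S / m) powr p)"
    by (simp add: mult.assoc)
  then have *: "m * (S / m) powr p \<le> (\<Sum>i\<in>I. a i powr p)"
    by (simp add: algebra_simps)
  have "S powr p = m powr (p - 1) * (m * (S / m) powr p)"
    using m S by (simp add: powr_diff powr_divide)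
  also have "\<dots> \<le> m powr (p - 1) * (\<Sum>i\<in>I. a i powr p)"
    using * by (intro mult_left_mono) auto
  finally show ?thesis by (simp add: S_def m_def)
qed (use assms in auto)

lemma abs_le_one_plus_powr:
  fixes a p :: real
  assumes "1 < p"
  shows "\<bar>a\<bar> \<le> 1 + \<bar>a\<bar> powr p"
  using assms powr_mono[of 1 p "\<bar>a\<bar>"] by (cases "\<bar>a\<bar> \<le> 1") (auto intro: add_increasing2)

text \<open>Hoelder's inequality raised to the power \<open>p\<close>. Real powers live on \<open>real\<close>, so the integral of
  the product is represented by an arbitrary real lower bound \<open>F\<close>, and only the integral of \<open>f\<close> to
  the power \<open>p\<close> is allowed to be infinite.\<close>

lemma holder_powr:
  fixes f g :: "'a \<Rightarrow> real"
  assumes [measurable]: "f \<in> borel_measurable M" "g \<in> borel_measurable M"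
    and nonneg: "\<And>x. 0 \<le> f x" "\<And>x. 0 \<le> g x" and p: "1 < p"
    and J: "(\<integral>\<^sup>+x. ennreal (g x powr (p / (p - 1))) \<partial>M) \<le> ennreal J" "0 < J"
    and F: "0 \<le> F" "ennreal F \<le> (\<integral>\<^sup>+x. ennreal (f x * g x) \<partial>M)"
  shows "ennreal (F powr p) \<le> ennreal (J powr (p - 1)) * (\<integral>\<^sup>+x. ennreal (f x powr p) \<partial>M)"
proof (cases "(\<integral>\<^sup>+x. ennreal (f x powr p) \<partial>M)")
  case top
  then show ?thesis using J by (simp add: ennreal_mult_top)
next
  case (real I)
  \<comment> \<open>The value of \<open>l\<close> that turns Young's inequality into an equality almost everywhere in the
    equality case of Hoelder's inequality.\<close>
  define l where "l = F / J"
  have l: "l \<ge> 0" using F J by (simp add: l_def)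
  have "ennreal (p * l powr (p - 1) * F) = ennreal (p * l powr (p - 1)) * ennreal F"
    using p l F by (simp add: ennreal_mult)
  also have "\<dots> \<le> ennreal (p * l powr (p - 1)) * (\<integral>\<^sup>+x. ennreal (f x * g x) \<partial>M)"
    by (intro mult_left_mono F) auto
  also have "\<dots> = (\<integral>\<^sup>+x. ennreal (p * l powr (p - 1) * (f x * g x)) \<partial>M)"
    using p nonneg by (subst nn_integral_cmult[symmetric]) (auto simp flip: ennreal_mult)
  also have "\<dots> \<le> (\<integral>\<^sup>+x. ennreal (f x powr p) + ennreal ((p - 1) * l powr p) * ennreal (g x powr (p / (p - 1))) \<partial>M)"
    using young_tangent[OF p nonneg(1) nonneg(2) l] p
    by (intro nn_integral_mono) (auto simp flip: ennreal_mult ennreal_plus intro!: ennreal_leI)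
  also have "\<dots> = ennreal I + ennreal ((p - 1) * l powr p) * (\<integral>\<^sup>+x. ennreal (g x powr (p / (p - 1))) \<partial>M)"
    by (subst nn_integral_add) (auto simp: nn_integral_cmult real)
  also have "\<dots> \<le> ennreal I + ennreal ((p - 1) * l powr p) * ennreal J"
    by (intro add_left_mono mult_left_mono J) auto
  also have "\<dots> = ennreal (I + (p - 1) * l powr p * J)"
    using p J real by (simp flip: ennreal_mult ennreal_plus)
  finally have 1: "p * l powr (p - 1) * F \<le> I + (p - 1) * l powr p * J"
    using p J real by (subst (asm) ennreal_le_iff) auto
  have "l powr (p - 1) * F = l powr p * J"
    using F J p by (cases "F = 0") (auto simp: l_def powr_diff)
  then have "p * l powr (p - 1) * F = p * (l powr p * J)" by (simp add: mult.assoc)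
  from 1[unfolded this] have "l powr p * J \<le> I" by (simp add: algebra_simps)
  then have "J powr (p - 1) * (l powr p * J) \<le> J powr (p - 1) * I"
    by (intro mult_left_mono) auto
  also have "J powr (p - 1) * (l powr p * J) = F powr p"
    using F J by (simp add: l_def powr_divide powr_diff)
  finally show ?thesis using real by (simp flip: ennreal_mult)
qed

section \<open>Muckenhoupt weights\<close>

definition weighted :: "('a::euclidean_space \<Rightarrow> real) \<Rightarrow> 'a measure" where
  "weighted w = density lborel (\<lambda>x. ennreal (w x))"

text \<open>Lets the measurability prover treat indicators of balls with variable centre and radius.\<close>

lemma pred_in_ball [measurable]:
  fixes f g :: "'b \<Rightarrow> 'a::euclidean_space"
  assumes [measurable]: "f \<in> borel_measurable M" "g \<in> borel_measurable M" "R \<in> borel_measurable M"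
  shows "Measurable.pred M (\<lambda>x. g x \<in> ball (f x) (R x))"
  unfolding mem_ball by measurable

lemma nn_integral_positive:
  fixes f :: "'a::euclidean_space \<Rightarrow> real"
  assumes "f \<in> borel_measurable lborel" "\<And>x. 0 < f x" "0 < \<rho>"
  shows "0 < (\<integral>\<^sup>+x\<in>ball (z::'a) \<rho>. ennreal (f x) \<partial>lborel)"
proof (rule ccontr)
  assume "\<not> ?thesis"
  then have "AE x in lborel. ennreal (f x) * indicator (ball z \<rho>) x = 0"
    using assms(1) by (subst nn_integral_0_iff_AE[symmetric]) auto
  then have "AE x in lborel. x \<notin> ball z \<rho>"
    by eventually_elim (use assms(2) in \<open>auto simp: ennreal_eq_0_iff not_less[symmetric] split: split_indicator_asm\<close>)
  then have "emeasure lborel (ball z \<rho>) = 0"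
    using AE_iff_measurable[of "ball z \<rho>" lborel "\<lambda>x. x \<notin> ball z \<rho>"] by (simp add: ball_def)
  then show False
    using assms(3) content_ball_pos[of \<rho> z] by (simp add: measure_def)
qed

lemma content_ball_scale: "0 \<le> t \<Longrightarrow> 0 \<le> \<rho> \<Longrightarrow> measure lborel (ball (z::'a::euclidean_space) (t * \<rho>)) = t ^ DIM('a) * measure lborel (ball (z'::'a) \<rho>)"
  by (simp add: content_ball power_mult_distrib)

text \<open>The \<open>A\<^sub>p\<close> condition for a Borel weight that is positive everywhere, multiplied by the \<open>p\<close>-th
  power of the volume so that no averages occur. The number \<open>K\<close> is any bound for the \<open>A\<^sub>p\<close>
  constant.\<close>

locale Ap_weight =
  fixes w :: "'a::euclidean_space \<Rightarrow> real" and p K :: real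
  assumes w_borel [measurable]: "w \<in> borel_measurable borel"
    and w_pos: "0 < w x"
    and p: "1 < p"
    and finite_on_balls: "emeasure (weighted w) (ball z \<rho>) < \<infinity>"
    and dual_finite: "(\<integral>\<^sup>+x\<in>ball z \<rho>. ennreal (w x powr (1 / (1 - p))) \<partial>lborel) < \<infinity>"
    and Ap: "0 < \<rho> \<Longrightarrow> measure (weighted w) (ball z \<rho>) *
        enn2real (\<integral>\<^sup>+x\<in>ball z \<rho>. ennreal (w x powr (1 / (1 - p))) \<partial>lborel) powr (p - 1)
        \<le> K * measure lborel (ball z \<rho>) powr p"
begin

abbreviation "\<mu> \<equiv> weighted w"

lemma sets_mu [measurable_cong]: "sets \<mu> = sets borel"
  by (simp add: weighted_def)

lemma space_mu [simp]: "space \<mu> = UNIV"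
  by (simp add: weighted_def)

lemma nn_integral_mu:
  "f \<in> borel_measurable borel \<Longrightarrow> (\<integral>\<^sup>+x. f x \<partial>\<mu>) = (\<integral>\<^sup>+x. ennreal (w x) * f x \<partial>lborel)"
  unfolding weighted_def by (subst nn_integral_density) auto

lemma w_nonneg: "0 \<le> w x"
  using w_pos[of x] by simp

lemma emeasure_mu_ball: "emeasure \<mu> (ball z \<rho>) = ennreal (measure \<mu> (ball z \<rho>))"
  using finite_on_balls[of z \<rho>] by (intro emeasure_eq_ennreal_measure) auto

lemma measure_mu_ball_pos: "0 < \<rho> \<Longrightarrow> 0 < measure \<mu> (ball z \<rho>)"
  using nn_integral_positive[of w \<rho> z] w_pos finite_on_balls[of z \<rho>]
  by (auto simp: measure_def enn2real_positive_iff weighted_def emeasure_density less_top)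

text \<open>The form in which the \<open>A\<^sub>p\<close> condition is used: the Lebesgue mean of \<open>f\<close> over a ball is
  controlled, to the power \<open>p\<close>, by the \<open>\<mu>\<close>-mean of \<open>f\<close> to the power \<open>p\<close>. This is Hoelder's
  inequality for the factorisation of \<open>f\<close> into \<open>f\<close> times \<open>w\<close> to the power \<open>1 / p\<close> and \<open>w\<close> to the
  power \<open>- 1 / p\<close>.\<close>

lemma Ap_average:
  assumes [measurable]: "f \<in> borel_measurable borel" and f: "\<And>x. 0 \<le> f x"
    and rho: "0 < \<rho>" and F: "0 \<le> F" "ennreal F \<le> (\<integral>\<^sup>+y\<in>ball z \<rho>. ennreal (f y) \<partial>lborel)"
  shows "ennreal (F powr p * measure \<mu> (ball z \<rho>))
    \<le> ennreal (K * measure lborel (ball z \<rho>) powr p) * (\<integral>\<^sup>+y\<in>ball z \<rho>. ennreal (f y powr p) \<partial>\<mu>)"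
proof -
  let ?D = "ball z \<rho>"
  have [measurable]: "?D \<in> sets borel" by simp
  define S where "S = (\<integral>\<^sup>+x\<in>?D. ennreal (w x powr (1 / (1 - p))) \<partial>lborel)"
  define J where "J = enn2real S"
  have Spos: "0 < S" unfolding S_def using w_pos[THEN less_imp_neq] rho
    by (intro nn_integral_positive) auto
  have J: "S = ennreal J" "J > 0"
    using Spos dual_finite[of z \<rho>] by (auto simp: J_def S_def[symmetric] enn2real_positive_iff less_top)
  define ff where "ff x = f x * w x powr (1 / p) * indicator ?D x" for x
  define gg where "gg x = w x powr (- 1 / p) * indicator ?D x" for x
  have pp: "ff x powr p = w x * (f x powr p) * indicator ?D x" for x
    using p w_pos[of x] by (auto simp: ff_def powr_mult powr_powr split: split_indicator)
  have gp: "gg x powr (p / (p - 1)) = w x powr (1 / (1 - p)) * indicator ?D x" for x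
    using p by (auto simp: gg_def powr_powr split: split_indicator intro!: arg_cong2[where f="(powr)"])
      (simp add: field_simps)
  have fg: "ff x * gg x = f x * indicator ?D x" for x
    using w_pos[of x] by (auto simp: ff_def gg_def powr_minus split: split_indicator)
  have "ennreal (F powr p) \<le> ennreal (J powr (p - 1)) * (\<integral>\<^sup>+x. ennreal (ff x powr p) \<partial>lborel)"
  proof (rule holder_powr[where g = gg])
    show "ff \<in> borel_measurable lborel" "gg \<in> borel_measurable lborel"
      unfolding ff_def gg_def by measurable
    show "(\<integral>\<^sup>+x. ennreal (gg x powr (p / (p - 1))) \<partial>lborel) \<le> ennreal J"
      using J(1) unfolding gp S_def by (simp add: ennreal_mult ennreal_indicator flip: ennreal_indicator)
    show "ennreal F \<le> (\<integral>\<^sup>+x. ennreal (ff x * gg x) \<partial>lborel)"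
      using F(2) unfolding fg by (simp add: f ennreal_mult ennreal_indicator)
  qed (use f p F J in \<open>auto simp: ff_def gg_def\<close>)
  also have "(\<integral>\<^sup>+x. ennreal (ff x powr p) \<partial>lborel) = (\<integral>\<^sup>+y\<in>ball z \<rho>. ennreal (f y powr p) \<partial>\<mu>)"
    by (subst nn_integral_mu) (auto simp: pp w_nonneg ennreal_mult ennreal_indicator mult.assoc)
  finally have 1: "ennreal (F powr p) \<le> ennreal (J powr (p - 1)) * (\<integral>\<^sup>+y\<in>?D. ennreal (f y powr p) \<partial>\<mu>)" .
  have "ennreal (F powr p * measure \<mu> ?D) = ennreal (measure \<mu> ?D) * ennreal (F powr p)"
    by (simp add: ennreal_mult mult.commute)
  also have "\<dots> \<le> ennreal (measure \<mu> ?D) * (ennreal (J powr (p - 1)) * (\<integral>\<^sup>+y\<in>?D. ennreal (f y powr p) \<partial>\<mu>))"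
    by (intro mult_left_mono 1) auto
  also have "\<dots> = ennreal (measure \<mu> ?D * J powr (p - 1)) * (\<integral>\<^sup>+y\<in>?D. ennreal (f y powr p) \<partial>\<mu>)"
    by (simp add: ennreal_mult mult.assoc)
  also have "\<dots> \<le> ennreal (K * measure lborel ?D powr p) * (\<integral>\<^sup>+y\<in>?D. ennreal (f y powr p) \<partial>\<mu>)"
    using Ap[OF rho, of z] by (intro mult_right_mono ennreal_leI) (auto simp: J_def S_def)
  finally show ?thesis .
qed

lemma K_nonneg: "0 \<le> K"
proof -
  have "0 \<le> K * measure lborel (ball (0::'a) 1) powr p"
    using Ap[of 1 0] by (rule order_trans[rotated]) auto
  then show ?thesis
    using content_ball_pos[of 1 "0::'a"] by (simp add: zero_le_mult_iff)
qed

text \<open>\<open>Ap_average\<close> on the ball of radius \<open>3 \<rho>\<close>, for the indicator of the ball of radius \<open>\<rho>\<close>.\<close>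

lemma doubling:
  assumes "0 < \<rho>"
  shows "measure \<mu> (ball z (3 * \<rho>)) \<le> K * 3 powr (DIM('a) * p) * measure \<mu> (ball z \<rho>)"
proof -
  let ?m = "measure lborel (ball z \<rho>)"
  have m: "?m > 0" using assms by (rule content_ball_pos)
  have "ennreal (?m powr p * measure \<mu> (ball z (3 * \<rho>)))
    \<le> ennreal (K * measure lborel (ball z (3 * \<rho>)) powr p) *
      (\<integral>\<^sup>+y\<in>ball z (3 * \<rho>). ennreal (indicator (ball z \<rho>) y powr p) \<partial>\<mu>)"
  proof (rule Ap_average)
    have "ennreal ?m = (\<integral>\<^sup>+y. indicator (ball z \<rho>) y \<partial>lborel)"
      using emeasure_lborel_ball_finite[of z \<rho>] by (simp add: emeasure_eq_ennreal_measure less_top)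
    also have "\<dots> = (\<integral>\<^sup>+y\<in>ball z (3 * \<rho>). ennreal (indicator (ball z \<rho>) y) \<partial>lborel)"
      using assms by (intro nn_integral_cong) (auto split: split_indicator)
    finally show "ennreal ?m \<le> (\<integral>\<^sup>+y\<in>ball z (3 * \<rho>). ennreal (indicator (ball z \<rho>) y) \<partial>lborel)"
      by simp
  qed (use assms in \<open>auto intro!: borel_measurable_indicator\<close>)
  also have "(\<integral>\<^sup>+y\<in>ball z (3 * \<rho>). ennreal (indicator (ball z \<rho>) y powr p) \<partial>\<mu>) = (\<integral>\<^sup>+y. indicator (ball z \<rho>) y \<partial>\<mu>)"
    using assms p by (intro nn_integral_cong) (auto split: split_indicator)
  also have "\<dots> = ennreal (measure \<mu> (ball z \<rho>))"
    by (simp add: sets_mu emeasure_mu_ball)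
  finally have "?m powr p * measure \<mu> (ball z (3 * \<rho>)) \<le> K * measure lborel (ball z (3 * \<rho>)) powr p * measure \<mu> (ball z \<rho>)"
    using K_nonneg by (simp flip: ennreal_mult)
  also have "measure lborel (ball z (3 * \<rho>)) powr p = 3 powr (DIM('a) * p) * ?m powr p"
    using assms by (subst content_ball_scale[where z' = z]) (auto simp: powr_mult powr_powr powr_realpow[symmetric])
  finally have "?m powr p * measure \<mu> (ball z (3 * \<rho>)) \<le> ?m powr p * (K * 3 powr (DIM('a) * p) * measure \<mu> (ball z \<rho>))"
    by (simp add: ac_simps)
  then show ?thesis using m by simp
qed

end

section \<open>Means over contracted copies of a ball\<close>

lemma nn_integral_ball_contract:
  fixes x x0 :: "'a::euclidean_space"
  assumes [measurable]: "f \<in> borel_measurable borel" and t: "0 < t"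
  shows "(\<integral>\<^sup>+z\<in>ball ((1 - t) *\<^sub>R x + t *\<^sub>R x0) (t * r). f z \<partial>lborel)
    = ennreal (t ^ DIM('a)) * (\<integral>\<^sup>+y\<in>ball x0 r. f (x + t *\<^sub>R (y - x)) \<partial>lborel)"
proof -
  let ?T = "\<lambda>y. (1 - t) *\<^sub>R x + t *\<^sub>R y"
  let ?c = "(1 - t) *\<^sub>R x + t *\<^sub>R x0"
  have mem: "?T y \<in> ball ?c (t * r) \<longleftrightarrow> y \<in> ball x0 r" for y
    using t by (simp add: dist_norm flip: scaleR_diff_right)
  have eq: "?T y = x + t *\<^sub>R (y - x)" for y
    by (simp add: algebra_simps)
  have "(\<integral>\<^sup>+z\<in>ball ?c (t * r). f z \<partial>lborel)
    = (\<integral>\<^sup>+z. f z * indicator (ball ?c (t * r)) z \<partial>density (distr lborel borel ?T) (\<lambda>_. \<bar>t\<bar> ^ DIM('a)))"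
    using lborel_affine[of t "(1 - t) *\<^sub>R x"] t by simp
  also have "\<dots> = (\<integral>\<^sup>+y. ennreal (t ^ DIM('a)) * (f (?T y) * indicator (ball ?c (t * r)) (?T y)) \<partial>lborel)"
    using t by (subst nn_integral_density; (subst nn_integral_distr)?) (auto simp: mult.assoc)
  also have "\<dots> = ennreal (t ^ DIM('a)) * (\<integral>\<^sup>+y. f (?T y) * indicator (ball ?c (t * r)) (?T y) \<partial>lborel)"
    by (subst nn_integral_cmult) auto
  also have "(\<lambda>y. indicator (ball ?c (t * r)) (?T y) :: ennreal) = indicator (ball x0 r)"
    using mem by (auto simp: indicator_def)
  finally show ?thesis by (simp add: eq)
qed

text \<open>The image of \<open>B = ball x0 r\<close> under the homothety with centre \<open>x\<close> and ratio \<open>t\<close> is again a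
  ball, which stays inside \<open>B\<close> because \<open>B\<close> is convex. This is why the \<open>A\<^sub>p\<close> condition, which
  speaks of balls, applies to it directly.\<close>

lemma contracted_ball_subset:
  fixes x x0 :: "'a::euclidean_space"
  assumes "x \<in> ball x0 r" "0 \<le> t" "t \<le> 1"
  shows "ball ((1 - t) *\<^sub>R x + t *\<^sub>R x0) (t * r) \<subseteq> ball x0 r"
    and "y \<in> ball ((1 - t) *\<^sub>R x + t *\<^sub>R x0) (t * r) \<Longrightarrow> dist x y < 2 * t * r"
proof -
  have d: "dist x0 ((1 - t) *\<^sub>R x + t *\<^sub>R x0) = (1 - t) * dist x0 x"
  proof -
    have "x0 - ((1 - t) *\<^sub>R x + t *\<^sub>R x0) = (1 - t) *\<^sub>R (x0 - x)" by (simp add: algebra_simps)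
    then show ?thesis using assms unfolding dist_norm by simp
  qed
  have d': "dist x ((1 - t) *\<^sub>R x + t *\<^sub>R x0) = t * dist x0 x"
  proof -
    have "x - ((1 - t) *\<^sub>R x + t *\<^sub>R x0) = t *\<^sub>R (x - x0)" by (simp add: algebra_simps)
    then show ?thesis using assms unfolding dist_norm by (simp add: norm_minus_commute)
  qed
  have "(1 - t) * dist x0 x \<le> (1 - t) * r" "t * dist x0 x \<le> t * r"
    using assms by (auto intro!: mult_left_mono)
  with d d' have e: "dist x0 ((1 - t) *\<^sub>R x + t *\<^sub>R x0) \<le> r - t * r"
     "dist x ((1 - t) *\<^sub>R x + t *\<^sub>R x0) \<le> t * r"
    by (auto simp: algebra_simps)
  show "ball ((1 - t) *\<^sub>R x + t *\<^sub>R x0) (t * r) \<subseteq> ball x0 r"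
  proof
    fix y assume "y \<in> ball ((1 - t) *\<^sub>R x + t *\<^sub>R x0) (t * r)"
    then show "y \<in> ball x0 r"
      using e(1) dist_triangle[of x0 y "(1 - t) *\<^sub>R x + t *\<^sub>R x0"] by simp
  qed
  show "dist x y < 2 * t * r" if "y \<in> ball ((1 - t) *\<^sub>R x + t *\<^sub>R x0) (t * r)"
    using that e(2) dist_triangle[of x y "(1 - t) *\<^sub>R x + t *\<^sub>R x0"] by simp
qed

text \<open>For \<open>0 < t\<close> the mean of \<open>g\<close> over \<open>x + t (B - x)\<close>; for \<open>t = 0\<close> the value \<open>g x\<close>. It is written
  as an average over the fixed set \<open>B\<close> in order to cover both cases.\<close>

definition contracted_mean :: "'a::euclidean_space set \<Rightarrow> ('a \<Rightarrow> real) \<Rightarrow> real \<Rightarrow> 'a \<Rightarrow> real" where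
  "contracted_mean B g t x =
     enn2real (\<integral>\<^sup>+y\<in>B. ennreal (g (x + t *\<^sub>R (y - x))) \<partial>lborel) / measure lborel B"

lemma nn_integral_contracted_finite:
  fixes x x0 :: "'a::euclidean_space"
  assumes [measurable]: "g \<in> borel_measurable borel"
    and fin: "(\<integral>\<^sup>+y\<in>ball x0 r. ennreal (g y) \<partial>lborel) < \<infinity>"
    and x: "x \<in> ball x0 r" and t: "0 \<le> t" "t \<le> 1"
  shows "(\<integral>\<^sup>+y\<in>ball x0 r. ennreal (g (x + t *\<^sub>R (y - x))) \<partial>lborel) < \<infinity>"
proof (cases "t = 0")
  case True
  then show ?thesis
    using emeasure_lborel_ball_finite[of x0 r]
    by (simp add: nn_integral_cmult_indicator ennreal_mult_less_top)
next
  case False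
  then have t0: "0 < t" using t by simp
  have "ennreal (t ^ DIM('a)) * (\<integral>\<^sup>+y\<in>ball x0 r. ennreal (g (x + t *\<^sub>R (y - x))) \<partial>lborel)
     = (\<integral>\<^sup>+z\<in>ball ((1 - t) *\<^sub>R x + t *\<^sub>R x0) (t * r). ennreal (g z) \<partial>lborel)"
    using t0 by (subst nn_integral_ball_contract) auto
  also have "\<dots> \<le> (\<integral>\<^sup>+y\<in>ball x0 r. ennreal (g y) \<partial>lborel)"
    using contracted_ball_subset(1)[OF x t] by (intro nn_integral_mono) (auto split: split_indicator)
  also note fin
  finally show ?thesis
    using t0 by (cases "(\<integral>\<^sup>+y\<in>ball x0 r. ennreal (g (x + t *\<^sub>R (y - x))) \<partial>lborel) = \<infinity>")
      (auto simp: ennreal_mult_top less_top)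
qed

lemma contracted_mean_measurable [measurable]:
  fixes g :: "'a::euclidean_space \<Rightarrow> real"
  assumes [measurable]: "g \<in> borel_measurable borel" "B \<in> sets borel"
  shows "contracted_mean B g t \<in> borel_measurable borel"
  unfolding contracted_mean_def by measurable

lemma contracted_mean_nonneg: "0 \<le> contracted_mean B g t x"
  by (simp add: contracted_mean_def)

context Ap_weight
begin

lemma sigma_finite_mu: "sigma_finite_measure \<mu>"
  unfolding weighted_def by (subst sigma_finite_measure.sigma_finite_iff_density_finite[OF sigma_finite_lborel]) auto

text \<open>The measure of a ball is an integral depending on the parameter \<open>y\<close>, so that its
  measurability is part of Fubini's theorem.\<close>

lemma measure_ball_measurable [measurable]: "(\<lambda>y. measure \<mu> (ball y R)) \<in> borel_measurable borel"
proof -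
  interpret sigma_finite_measure \<mu> by (rule sigma_finite_mu)
  have "emeasure \<mu> (ball y R) = (\<integral>\<^sup>+x. indicator (ball y R) x \<partial>\<mu>)" for y
    by (simp add: sets_mu)
  then show ?thesis
    unfolding measure_def by simp
qed

text \<open>The averaging operators are bounded on \<open>L\<^sup>p(\<mu>)\<close> uniformly in \<open>t\<close>. After \<open>Ap_average\<close> on
  \<open>x + t (B - x)\<close>, Fubini's theorem leaves the integral over \<open>x\<close> of \<open>1 / \<mu>(x + t (B - x))\<close> over
  those \<open>x\<close> with \<open>y \<in> x + t (B - x)\<close>. They lie in the ball of radius \<open>2 t r\<close> around \<open>y\<close>, whose
  measure is comparable to that of \<open>x + t (B - x)\<close> by doubling. The summand \<open>1\<close> in the constant is
  there for \<open>t = 0\<close>.\<close>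

lemma contracted_mean_bound:
  assumes [measurable]: "g \<in> borel_measurable borel" and g: "\<And>x. 0 \<le> g x"
    and fin: "(\<integral>\<^sup>+y\<in>ball x0 r. ennreal (g y) \<partial>lborel) < \<infinity>"
    and r: "0 < r" and t: "0 \<le> t" "t \<le> 1"
  shows "(\<integral>\<^sup>+x\<in>ball x0 r. ennreal (contracted_mean (ball x0 r) g t x powr p) \<partial>\<mu>)
    \<le> ennreal (1 + K\<^sup>2 * 3 powr (DIM('a) * p)) * (\<integral>\<^sup>+y\<in>ball x0 r. ennreal (g y powr p) \<partial>\<mu>)"
    (is "?L \<le> _ * ?R")
proof (cases "t = 0")
  case True
  have "contracted_mean (ball x0 r) g t x = g x" for x
    using True g[of x] content_ball_pos[OF r, of x0]
    by (simp add: contracted_mean_def nn_integral_cmult_indicator enn2real_mult measure_def)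
  then have "?L = ?R" by simp
  also have "\<dots> = ennreal 1 * ?R" by simp
  also have "\<dots> \<le> ennreal (1 + K\<^sup>2 * 3 powr (DIM('a) * p)) * ?R"
    by (intro mult_right_mono ennreal_leI) auto
  finally show ?thesis .
next
  case False
  then have t0: "0 < t" using t by simp
  interpret sigma_finite_measure \<mu> by (rule sigma_finite_mu)
  interpret P: pair_sigma_finite \<mu> \<mu> by unfold_locales
  let ?B = "ball x0 r"
  let ?D = "\<lambda>x. ball ((1 - t) *\<^sub>R x + t *\<^sub>R x0) (t * r)"
  let ?Q = "K\<^sup>2 * 3 powr (DIM('a) * p)"
  let ?W = "\<lambda>y. measure \<mu> (ball y (2 * t * r))"
  have tr: "0 < t * r" using t0 r by simp
  have pt: "ennreal (contracted_mean ?B g t x powr p) 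
     \<le> (\<integral>\<^sup>+y. ennreal ?Q * (ennreal (g y powr p / ?W y) * indicator ?B y * indicator (ball y (2 * t * r)) x) \<partial>\<mu>)"
    (is "_ \<le> ?I x") if x: "x \<in> ?B" for x
  proof -
    let ?a = "contracted_mean ?B g t x"
    let ?m = "measure lborel (?D x)"
    have m: "?m > 0" using tr by (rule content_ball_pos)
    have m_eq: "?m = t ^ DIM('a) * measure lborel ?B"
      using t r by (intro content_ball_scale) auto
    have "ennreal (?m * ?a) = ennreal (t ^ DIM('a)) * ennreal (enn2real (\<integral>\<^sup>+y\<in>?B. ennreal (g (x + t *\<^sub>R (y - x))) \<partial>lborel))"
      using content_ball_pos[OF r, of x0] t unfolding m_eq contracted_mean_def by (simp flip: ennreal_mult)
    also have "\<dots> = (\<integral>\<^sup>+z\<in>?D x. ennreal (g z) \<partial>lborel)"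
      using nn_integral_contracted_finite[OF assms(1) fin x t] t0
      by (subst nn_integral_ball_contract) auto
    finally have "ennreal ((?m * ?a) powr p * measure \<mu> (?D x))
       \<le> ennreal (K * ?m powr p) * (\<integral>\<^sup>+y\<in>?D x. ennreal (g y powr p) \<partial>\<mu>)"
      using m g tr by (intro Ap_average) (auto intro!: mult_nonneg_nonneg contracted_mean_nonneg)
    then have "ennreal (1 / (?m powr p * measure \<mu> (?D x))) * ennreal ((?m * ?a) powr p * measure \<mu> (?D x))
       \<le> ennreal (1 / (?m powr p * measure \<mu> (?D x))) * (ennreal (K * ?m powr p) * (\<integral>\<^sup>+y\<in>?D x. ennreal (g y powr p) \<partial>\<mu>))"
      by (rule mult_left_mono) auto
    then have "ennreal (?a powr p) \<le> ennreal (K / measure \<mu> (?D x)) * (\<integral>\<^sup>+y\<in>?D x. ennreal (g y powr p) \<partial>\<mu>)"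
      using m measure_mu_ball_pos[OF tr, of "(1 - t) *\<^sub>R x + t *\<^sub>R x0"] contracted_mean_nonneg[of ?B g t x] K_nonneg
      by (simp add: powr_mult mult.assoc[symmetric] flip: ennreal_mult)
    also have "\<dots> = (\<integral>\<^sup>+y. ennreal (K / measure \<mu> (?D x)) * (ennreal (g y powr p) * indicator (?D x) y) \<partial>\<mu>)"
      by (subst nn_integral_cmult) auto
    also have "\<dots> \<le> ?I x"
    proof (intro nn_integral_mono)
      fix y
      show "ennreal (K / measure \<mu> (?D x)) * (ennreal (g y powr p) * indicator (?D x) y)
        \<le> ennreal ?Q * (ennreal (g y powr p / ?W y) * indicator ?B y * indicator (ball y (2 * t * r)) x)"
      proof (cases "y \<in> ?D x")
        case True
        have yB: "y \<in> ?B" and xy: "x \<in> ball y (2 * t * r)"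
          using True contracted_ball_subset(1)[OF x t] contracted_ball_subset(2)[OF x t, of y] by (auto simp: dist_commute)
        have Wpos: "0 < ?W y" "0 < measure \<mu> (?D x)"
          using t0 r tr by (auto intro!: measure_mu_ball_pos)
        have sub: "ball y (2 * t * r) \<subseteq> ball ((1 - t) *\<^sub>R x + t *\<^sub>R x0) (3 * (t * r))"
        proof
          fix z assume "z \<in> ball y (2 * t * r)"
          then show "z \<in> ball ((1 - t) *\<^sub>R x + t *\<^sub>R x0) (3 * (t * r))"
            using True dist_triangle[of "(1 - t) *\<^sub>R x + t *\<^sub>R x0" z y] by simp
        qed
        have "emeasure \<mu> (ball y (2 * t * r)) \<le> emeasure \<mu> (ball ((1 - t) *\<^sub>R x + t *\<^sub>R x0) (3 * (t * r)))"
          using sub by (intro emeasure_mono) (auto simp: sets_mu)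
        then have "?W y \<le> measure \<mu> (ball ((1 - t) *\<^sub>R x + t *\<^sub>R x0) (3 * (t * r)))"
          by (simp add: emeasure_mu_ball)
        also have "\<dots> \<le> K * 3 powr (DIM('a) * p) * measure \<mu> (?D x)"
          by (rule doubling[OF tr])
        finally have "K * ?W y \<le> K * (K * 3 powr (DIM('a) * p) * measure \<mu> (?D x))"
          using K_nonneg by (rule mult_left_mono)
        then have "K / measure \<mu> (?D x) \<le> ?Q / ?W y"
          using Wpos by (simp add: field_simps power2_eq_square)
        then have "K / measure \<mu> (?D x) * g y powr p \<le> ?Q / ?W y * g y powr p"
          by (rule mult_right_mono) auto
        then show ?thesis
          using True yB xy K_nonneg Wpos by (simp add: ennreal_leI flip: ennreal_mult)
      qed auto
    qed
    finally show ?thesis .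
  qed
  \<comment> \<open>The restriction of \<open>x\<close> to \<open>B\<close> is dropped here, so that the integral over \<open>x\<close> produces the
    full measure of the ball around \<open>y\<close>.\<close>
  have "?L \<le> (\<integral>\<^sup>+x. (\<integral>\<^sup>+y. ennreal ?Q * (ennreal (g y powr p / ?W y) * indicator ?B y * indicator (ball y (2 * t * r)) x) \<partial>\<mu>) \<partial>\<mu>)"
    using pt by (intro nn_integral_mono) (auto split: split_indicator)
  also have "\<dots> = (\<integral>\<^sup>+y. (\<integral>\<^sup>+x. ennreal ?Q * (ennreal (g y powr p / ?W y) * indicator ?B y * indicator (ball y (2 * t * r)) x) \<partial>\<mu>) \<partial>\<mu>)"
    by (rule P.Fubini') measurable
  also have "\<dots> = (\<integral>\<^sup>+y. ennreal ?Q * (ennreal (g y powr p) * indicator ?B y) \<partial>\<mu>)"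
  proof (intro nn_integral_cong)
    fix y
    have W: "0 < ?W y" using t0 r by (intro measure_mu_ball_pos) auto
    have "(\<integral>\<^sup>+x. ennreal ?Q * (ennreal (g y powr p / ?W y) * indicator ?B y * indicator (ball y (2 * t * r)) x) \<partial>\<mu>)
      = ennreal ?Q * (ennreal (g y powr p / ?W y) * indicator ?B y * emeasure \<mu> (ball y (2 * t * r)))"
      by (simp add: nn_integral_cmult mult.assoc sets_mu)
    also have "\<dots> = ennreal ?Q * (ennreal (g y powr p) * indicator ?B y)"
      using W by (simp add: emeasure_mu_ball ennreal_mult[symmetric] split: split_indicator)
    finally show "(\<integral>\<^sup>+x. ennreal ?Q * (ennreal (g y powr p / ?W y) * indicator ?B y * indicator (ball y (2 * t * r)) x) \<partial>\<mu>)
      = ennreal ?Q * (ennreal (g y powr p) * indicator ?B y)" .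
  qed
  also have "\<dots> = ennreal ?Q * ?R"
    by (subst nn_integral_cmult) auto
  also have "\<dots> \<le> ennreal (1 + ?Q) * ?R"
    by (intro mult_right_mono ennreal_leI) auto
  finally show ?thesis .
qed

end

section \<open>Local oscillation and chains along segments\<close>

definition local_osc :: "'a::euclidean_space set \<Rightarrow> real \<Rightarrow> ('a \<Rightarrow> real) \<Rightarrow> 'a \<Rightarrow> ennreal" where
  "local_osc B R v z = (\<integral>\<^sup>+y\<in>ball z R. ennreal (\<bar>v z - v y\<bar> * indicator B y) \<partial>lborel)"

lemma local_osc_measurable [measurable]:
  fixes v :: "'a::euclidean_space \<Rightarrow> real"
  assumes [measurable]: "v \<in> borel_measurable borel" "B \<in> sets borel"
  shows "local_osc B R v \<in> borel_measurable borel"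
  unfolding local_osc_def by measurable

lemma local_osc_le:
  fixes v :: "'a::euclidean_space \<Rightarrow> real"
  assumes [measurable]: "v \<in> borel_measurable borel" "B \<in> sets borel"
  shows "local_osc B R v z \<le> ennreal \<bar>v z\<bar> * emeasure lborel B + (\<integral>\<^sup>+y\<in>B. ennreal \<bar>v y\<bar> \<partial>lborel)"
proof -
  have "local_osc B R v z \<le> (\<integral>\<^sup>+y. ennreal \<bar>v z\<bar> * indicator B y + ennreal \<bar>v y\<bar> * indicator B y \<partial>lborel)"
    unfolding local_osc_def
    by (intro nn_integral_mono) (auto split: split_indicator intro!: ennreal_leI simp flip: ennreal_plus)
  also have "\<dots> = ennreal \<bar>v z\<bar> * emeasure lborel B + (\<integral>\<^sup>+y\<in>B. ennreal \<bar>v y\<bar> \<partial>lborel)"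
    by (subst nn_integral_add) (auto simp: nn_integral_cmult_indicator)
  finally show ?thesis .
qed

lemma local_osc_finite:
  fixes v :: "'a::euclidean_space \<Rightarrow> real"
  assumes [measurable]: "v \<in> borel_measurable borel"
    and fin: "(\<integral>\<^sup>+y\<in>ball x0 r. ennreal \<bar>v y\<bar> \<partial>lborel) < \<infinity>"
  shows "local_osc (ball x0 r) R v z < \<infinity>"
    and "(\<integral>\<^sup>+z\<in>ball x0 r. local_osc (ball x0 r) R v z \<partial>lborel) < \<infinity>"
proof -
  have "local_osc (ball x0 r) R v z \<le> ennreal \<bar>v z\<bar> * emeasure lborel (ball x0 r) + (\<integral>\<^sup>+y\<in>ball x0 r. ennreal \<bar>v y\<bar> \<partial>lborel)" for z
    by (rule local_osc_le) auto
  note le = this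
  show "local_osc (ball x0 r) R v z < \<infinity>"
    using fin emeasure_lborel_ball_finite[of x0 r]
    by (intro le_less_trans[OF le]) (auto simp: ennreal_mult_less_top)
  have "(\<integral>\<^sup>+z\<in>ball x0 r. local_osc (ball x0 r) R v z \<partial>lborel)
    \<le> (\<integral>\<^sup>+z. emeasure lborel (ball x0 r) * (ennreal \<bar>v z\<bar> * indicator (ball x0 r) z)
        + (\<integral>\<^sup>+y\<in>ball x0 r. ennreal \<bar>v y\<bar> \<partial>lborel) * indicator (ball x0 r) z \<partial>lborel)"
    using le by (intro nn_integral_mono) (auto split: split_indicator simp: mult.commute)
  also have "\<dots> = emeasure lborel (ball x0 r) * (\<integral>\<^sup>+y\<in>ball x0 r. ennreal \<bar>v y\<bar> \<partial>lborel)
     + (\<integral>\<^sup>+y\<in>ball x0 r. ennreal \<bar>v y\<bar> \<partial>lborel) * emeasure lborel (ball x0 r)"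
    by (subst nn_integral_add) (auto simp: nn_integral_cmult nn_integral_cmult_indicator)
  also have "\<dots> < \<infinity>"
    using fin emeasure_lborel_ball_finite[of x0 r] by (auto simp: ennreal_mult_less_top)
  finally show "(\<integral>\<^sup>+z\<in>ball x0 r. local_osc (ball x0 r) R v z \<partial>lborel) < \<infinity>" .
qed

text \<open>Up to a factor depending on the dimension, the mean of \<open>|v z - v y|\<close> over the ball of radius
  \<open>4 e r\<close> around \<open>z\<close>. The normalising volume is that of a ball of radius \<open>e r\<close>, because this is
  the size of the set over which the triangle inequality is averaged in \<open>diff_le_local_mean_osc\<close>.\<close>

definition local_mean_osc :: "'a::euclidean_space \<Rightarrow> real \<Rightarrow> real \<Rightarrow> ('a \<Rightarrow> real) \<Rightarrow> 'a \<Rightarrow> real" where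
  "local_mean_osc x0 r e v z =
     enn2real (local_osc (ball x0 r) (4 * e * r) v z) / measure lborel (ball x0 (e * r))"

lemma local_mean_osc_measurable [measurable]:
  fixes v :: "'a::euclidean_space \<Rightarrow> real"
  assumes [measurable]: "v \<in> borel_measurable borel"
  shows "local_mean_osc x0 r e v \<in> borel_measurable borel"
  unfolding local_mean_osc_def by measurable

lemma local_mean_osc_nonneg: "0 \<le> local_mean_osc x0 r e v z"
  by (simp add: local_mean_osc_def)

lemma local_mean_osc_integral_finite:
  fixes v :: "'a::euclidean_space \<Rightarrow> real"
  assumes [measurable]: "v \<in> borel_measurable borel"
    and fin: "(\<integral>\<^sup>+y\<in>ball x0 r. ennreal \<bar>v y\<bar> \<partial>lborel) < \<infinity>"
    and r: "0 < r" and e: "0 < e"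
  shows "(\<integral>\<^sup>+z\<in>ball x0 r. ennreal (local_mean_osc x0 r e v z) \<partial>lborel) < \<infinity>"
proof -
  let ?m = "measure lborel (ball x0 (e * r))"
  have "ennreal (local_mean_osc x0 r e v z) = ennreal (1 / ?m) * local_osc (ball x0 r) (4 * e * r) v z" for z
  proof -
    have "ennreal (enn2real (local_osc (ball x0 r) (4 * e * r) v z)) = local_osc (ball x0 r) (4 * e * r) v z"
      using local_osc_finite(1)[OF assms(1) fin] by (intro ennreal_enn2real) auto
    moreover have "ennreal (local_mean_osc x0 r e v z) = ennreal (1 / ?m) * ennreal (enn2real (local_osc (ball x0 r) (4 * e * r) v z))"
      unfolding local_mean_osc_def by (simp flip: ennreal_mult)
    ultimately show ?thesis by simp
  qed
  then have "(\<integral>\<^sup>+z\<in>ball x0 r. ennreal (local_mean_osc x0 r e v z) \<partial>lborel)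
     = ennreal (1 / ?m) * (\<integral>\<^sup>+z\<in>ball x0 r. local_osc (ball x0 r) (4 * e * r) v z \<partial>lborel)"
    by (subst nn_integral_cmult[symmetric]) (auto simp: mult.assoc)
  then show ?thesis
    using local_osc_finite(2)[OF assms(1) fin] by (auto simp: ennreal_mult_less_top)
qed

text \<open>Average \<open>|v z - v z'| \<le> |v z - v y| + |v y - v z'|\<close> over \<open>y\<close> in \<open>z + e (B - z)\<close>. This ball
  has the volume of a ball of radius \<open>e r\<close>, lies in \<open>B\<close>, and its points are at distance less than
  \<open>4 e r\<close> from both \<open>z\<close> and \<open>z'\<close>.\<close>

lemma diff_le_local_mean_osc:
  fixes v :: "'a::euclidean_space \<Rightarrow> real"
  assumes [measurable]: "v \<in> borel_measurable borel"
    and fin: "(\<integral>\<^sup>+y\<in>ball x0 r. ennreal \<bar>v y\<bar> \<partial>lborel) < \<infinity>"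
    and r: "0 < r" and e: "0 < e" "e \<le> 1"
    and z: "z \<in> ball x0 r" and near: "dist z z' < 2 * e * r"
  shows "\<bar>v z - v z'\<bar> \<le> local_mean_osc x0 r e v z + local_mean_osc x0 r e v z'"
proof -
  let ?S = "ball ((1 - e) *\<^sub>R z + e *\<^sub>R x0) (e * r)"
  let ?m = "measure lborel (ball x0 (e * r))"
  let ?o = "local_osc (ball x0 r) (4 * e * r) v"
  have m: "0 < ?m" using r e by (intro content_ball_pos) auto
  have S: "emeasure lborel ?S = ennreal ?m"
    using e r emeasure_lborel_ball_finite[of x0 "e * r"] by (simp add: emeasure_ball content_ball)
  have "ennreal (\<bar>v z - v z'\<bar> * ?m) = (\<integral>\<^sup>+y. ennreal \<bar>v z - v z'\<bar> * indicator ?S y \<partial>lborel)"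
    using S by (subst nn_integral_cmult_indicator) (auto simp: ennreal_mult)
  also have "\<dots> \<le> (\<integral>\<^sup>+y. ennreal (\<bar>v z - v y\<bar> * indicator (ball x0 r) y) * indicator (ball z (4 * e * r)) y
      + ennreal (\<bar>v z' - v y\<bar> * indicator (ball x0 r) y) * indicator (ball z' (4 * e * r)) y \<partial>lborel)"
  proof (intro nn_integral_mono)
    fix y
    show "ennreal \<bar>v z - v z'\<bar> * indicator ?S y \<le> ennreal (\<bar>v z - v y\<bar> * indicator (ball x0 r) y) * indicator (ball z (4 * e * r)) y
      + ennreal (\<bar>v z' - v y\<bar> * indicator (ball x0 r) y) * indicator (ball z' (4 * e * r)) y"
    proof (cases "y \<in> ?S")
      case True
      have yB: "y \<in> ball x0 r" and zy: "dist z y < 2 * e * r"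
        using True contracted_ball_subset(1)[OF z, of e] contracted_ball_subset(2)[OF z, of e y] e by auto
      have "dist z' y < 4 * e * r"
        using zy near dist_triangle[of z' y z] by (simp add: dist_commute)
      moreover have "dist z y < 4 * e * r"
        using zy mult_pos_pos[OF e(1) r] by linarith
      ultimately show ?thesis
        using True yB by (auto intro!: ennreal_leI simp flip: ennreal_plus)
    qed auto
  qed
  also have "\<dots> = ?o z + ?o z'"
    unfolding local_osc_def by (subst nn_integral_add) auto
  also have "\<dots> = ennreal (enn2real (?o z) + enn2real (?o z'))"
    using local_osc_finite(1)[OF assms(1) fin] by (simp add: ennreal_enn2real less_top)
  finally have "\<bar>v z - v z'\<bar> * ?m \<le> enn2real (?o z) + enn2real (?o z')"
    by (subst (asm) ennreal_le_iff) auto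
  then show ?thesis
    using m by (simp add: local_mean_osc_def field_simps)
qed

text \<open>The segment from \<open>x\<close> to \<open>y\<close> is divided into \<open>N\<close> steps, each shorter than \<open>2 r / N\<close>, and the
  two-point inequality is applied to each step. The number of terms, \<open>2 N\<close>, is the source of the
  factor \<open>N\<^sup>p\<close>.\<close>

lemma diff_le_chain:
  fixes v :: "'a::euclidean_space \<Rightarrow> real"
  assumes [measurable]: "v \<in> borel_measurable borel"
    and fin: "(\<integral>\<^sup>+y\<in>ball x0 r. ennreal \<bar>v y\<bar> \<partial>lborel) < \<infinity>"
    and r: "0 < r" and N: "0 < N"
    and x: "x \<in> ball x0 r" and y: "y \<in> ball x0 r"
  defines "g \<equiv> local_mean_osc x0 r (1 / real N) v"
  shows "\<bar>v x - v y\<bar> \<le> (\<Sum>i<N. g (x + (real i / real N) *\<^sub>R (y - x)) + g (x + (real (Suc i) / real N) *\<^sub>R (y - x)))"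
proof -
  define z where "z i = x + (real i / real N) *\<^sub>R (y - x)" for i
  have zB: "z i \<in> ball x0 r" if "i \<le> N" for i
  proof -
    have "(1 - real i / real N) *\<^sub>R x + (real i / real N) *\<^sub>R y \<in> ball x0 r"
      using that N x y by (intro convexD[OF convex_ball]) auto
    then show ?thesis by (simp add: z_def algebra_simps)
  qed
  have near: "dist (z i) (z (Suc i)) < 2 * (1 / real N) * r" for i
  proof -
    have "z (Suc i) - z i = (1 / real N) *\<^sub>R (y - x)"
      by (simp add: z_def add_divide_distrib algebra_simps)
    then have "norm (z (Suc i) - z i) = norm (y - x) / real N"
      by simp
    then have "dist (z i) (z (Suc i)) = dist x y / real N"
      by (simp add: dist_norm norm_minus_commute)
    also have "\<dots> < 2 * r / real N"
      using x y dist_triangle[of x y x0] N by (intro divide_strict_right_mono) (auto simp: dist_commute)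
    finally show ?thesis by simp
  qed
  have "v y - v x = (\<Sum>i<N. v (z (Suc i)) - v (z i))"
    using N by (subst sum_lessThan_telescope) (simp add: z_def)
  then have "\<bar>v x - v y\<bar> = \<bar>\<Sum>i<N. v (z (Suc i)) - v (z i)\<bar>" by simp
  also have "\<dots> \<le> (\<Sum>i<N. \<bar>v (z (Suc i)) - v (z i)\<bar>)" by (rule sum_abs)
  also have "\<dots> \<le> (\<Sum>i<N. g (z i) + g (z (Suc i)))"
  proof (rule sum_mono)
    fix i assume "i \<in> {..<N}"
    then show "\<bar>v (z (Suc i)) - v (z i)\<bar> \<le> g (z i) + g (z (Suc i))"
      using diff_le_local_mean_osc[OF assms(1) fin r, of "1 / real N" "z i" "z (Suc i)"] zB[of i] near[of i] N
      unfolding g_def by (simp add: abs_minus_commute)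
  qed
  finally show ?thesis unfolding z_def .
qed

text \<open>Averaging the chain inequality over \<open>y \<in> B\<close> turns the value of \<open>g\<close> at the point
  \<open>x + t (y - x)\<close> into its mean over the contracted ball.\<close>

lemma abs_diff_mean_le:
  fixes v :: "'a::euclidean_space \<Rightarrow> real"
  assumes [measurable]: "v \<in> borel_measurable borel"
    and fin: "(\<integral>\<^sup>+y\<in>ball x0 r. ennreal \<bar>v y\<bar> \<partial>lborel) < \<infinity>"
    and r: "0 < r" and N: "0 < N" and x: "x \<in> ball x0 r"
    and c: "c = (\<integral>y. v y * indicator (ball x0 r) y \<partial>lborel) / measure lborel (ball x0 r)"
  defines "g \<equiv> local_mean_osc x0 r (1 / real N) v"
  shows "\<bar>v x - c\<bar> \<le> (\<Sum>i<N. contracted_mean (ball x0 r) g (real i / real N) x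
      + contracted_mean (ball x0 r) g (real (Suc i) / real N) x)"
proof -
  let ?B = "ball x0 r" 
  let ?b = "measure lborel ?B"
  let ?G = "\<lambda>t. (\<integral>\<^sup>+y\<in>?B. ennreal (g (x + t *\<^sub>R (y - x))) \<partial>lborel)"
  have g_meas [measurable]: "g \<in> borel_measurable borel" unfolding g_def by measurable
  have g0: "0 \<le> g z" for z unfolding g_def by (rule local_mean_osc_nonneg)
  have b: "0 < ?b" using r by (rule content_ball_pos)
  have gfin: "(\<integral>\<^sup>+z\<in>?B. ennreal (g z) \<partial>lborel) < \<infinity>"
    unfolding g_def using N by (intro local_mean_osc_integral_finite assms) auto
  have Gfin: "?G t = ennreal (enn2real (?G t))" if "0 \<le> t" "t \<le> 1" for t
    using nn_integral_contracted_finite[OF g_meas gfin x that] by simp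
  have int_v: "integrable lborel (\<lambda>y. v y * indicator ?B y)"
    using fin by (intro integrableI_bounded) (auto simp: abs_mult ennreal_mult ennreal_indicator)
  have int_1: "integrable lborel (\<lambda>y. indicator ?B y :: real)"
    using emeasure_lborel_ball_finite[of x0 r] by (intro integrable_real_indicator) auto
  have "?b * (v x - c) = (\<integral>y. v x * indicator ?B y - v y * indicator ?B y \<partial>lborel)"
    using int_v int_1 b c by (subst Bochner_Integration.integral_diff) (auto simp: field_simps)
  then have "norm (\<integral>y. v x * indicator ?B y - v y * indicator ?B y \<partial>lborel) = norm (?b * (v x - c))"
    by simp
  then have "ennreal (?b * \<bar>v x - c\<bar>) = ennreal (norm (\<integral>y. v x * indicator ?B y - v y * indicator ?B y \<partial>lborel))"
    using b by (simp add: abs_mult)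
  also have "\<dots> \<le> (\<integral>\<^sup>+y. ennreal (norm (v x * indicator ?B y - v y * indicator ?B y)) \<partial>lborel)"
    using int_v int_1 by (intro integral_norm_bound_ennreal) auto
  also have "\<dots> \<le> (\<integral>\<^sup>+y. (\<Sum>i<N. ennreal (g (x + (real i / real N) *\<^sub>R (y - x))) * indicator ?B y
        + ennreal (g (x + (real (Suc i) / real N) *\<^sub>R (y - x))) * indicator ?B y) \<partial>lborel)"
  proof (intro nn_integral_mono)
    fix y
    show "ennreal (norm (v x * indicator ?B y - v y * indicator ?B y)) \<le> (\<Sum>i<N. ennreal (g (x + (real i / real N) *\<^sub>R (y - x))) * indicator ?B y
        + ennreal (g (x + (real (Suc i) / real N) *\<^sub>R (y - x))) * indicator ?B y)"
    proof (cases "y \<in> ?B")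
      case True
      then show ?thesis
        using diff_le_chain[OF assms(1) fin r N x True] g0
        by (simp add: g_def[symmetric] sum_nonneg ennreal_leI flip: ennreal_plus)
    qed simp
  qed
  also have "\<dots> = (\<Sum>i<N. ?G (real i / real N) + ?G (real (Suc i) / real N))"
    by (subst nn_integral_sum; (subst nn_integral_add)?) auto
  also have "\<dots> = (\<Sum>i<N. ennreal (?b * (contracted_mean ?B g (real i / real N) x
      + contracted_mean ?B g (real (Suc i) / real N) x)))"
  proof (rule sum.cong)
    fix i assume "i \<in> {..<N}"
    then have "?G (real i / real N) = ennreal (enn2real (?G (real i / real N)))"
       "?G (real (Suc i) / real N) = ennreal (enn2real (?G (real (Suc i) / real N)))"
      by (intro Gfin; simp)+
    then show "?G (real i / real N) + ?G (real (Suc i) / real N) = ennreal (?b * (contracted_mean ?B g (real i / real N) x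
      + contracted_mean ?B g (real (Suc i) / real N) x))"
      using b by (simp add: contracted_mean_def distrib_left)
  qed simp
  also have "\<dots> = ennreal (?b * (\<Sum>i<N. contracted_mean ?B g (real i / real N) x
      + contracted_mean ?B g (real (Suc i) / real N) x))"
    by (subst sum_ennreal) (auto simp: sum_distrib_left intro!: mult_nonneg_nonneg add_nonneg_nonneg contracted_mean_nonneg)
  finally have "?b * \<bar>v x - c\<bar> \<le> ?b * (\<Sum>i<N. contracted_mean ?B g (real i / real N) x
      + contracted_mean ?B g (real (Suc i) / real N) x)"
    by (subst (asm) ennreal_le_iff) (auto intro!: mult_nonneg_nonneg sum_nonneg add_nonneg_nonneg contracted_mean_nonneg)
  then show ?thesis using b by simp
qed

section \<open>The Poincare inequality at a fixed scale\<close>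

lemma add_powr_le:
  fixes a b p :: real
  assumes "1 < p" "0 \<le> a" "0 \<le> b"
  shows "(a + b) powr p \<le> 2 powr (p - 1) * (a powr p + b powr p)"
  using sum_powr_le[of "{False, True}" p "\<lambda>i. if i then b else a"] assms by simp

text \<open>Its factors are the power mean of \<open>2 N\<close> terms (apart from \<open>N\<^sup>p\<close>), the norm of the averaging
  operators, and the bound for the local oscillation; \<open>n\<close> is the dimension.\<close>

definition scale_const :: "nat \<Rightarrow> real \<Rightarrow> real \<Rightarrow> real" where
  "scale_const n p K = 2 powr p * (1 + K\<^sup>2 * 3 powr (n * p)) * (K * 4 powr (n * p))"

context Ap_weight
begin

text \<open>The Gagliardo integrand without the singular factor \<open>|x - y|\<close> to the power \<open>- s p\<close>.\<close>

definition gagliardo_kernel :: "('a \<Rightarrow> real) \<Rightarrow> 'a \<Rightarrow> 'a \<Rightarrow> real" where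
  "gagliardo_kernel v x y = \<bar>v x - v y\<bar> powr p * (w x * w y / measure \<mu> (ball ((1/2) *\<^sub>R (x + y)) (norm (x - y) / 2)))"

lemma gagliardo_kernel_nonneg: "0 \<le> gagliardo_kernel v x y"
  unfolding gagliardo_kernel_def using w_nonneg[of x] w_nonneg[of y] by simp

text \<open>Joint measurability: the measure of the ball between \<open>x\<close> and \<open>y\<close> is the integral of its
  indicator, which is a measurable function of three variables.\<close>

lemma gagliardo_kernel_measurable [measurable]:
  assumes [measurable]: "v \<in> borel_measurable borel"
  shows "(\<lambda>q. gagliardo_kernel v (fst q) (snd q)) \<in> borel_measurable (borel \<Otimes>\<^sub>M borel)"
proof -
  interpret sigma_finite_measure \<mu> by (rule sigma_finite_mu)
  let ?b = "\<lambda>q::'a \<times> 'a. ball ((1/2) *\<^sub>R (fst q + snd q)) (norm (fst q - snd q) / 2)"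
  have eq: "emeasure \<mu> (?b q) = (\<integral>\<^sup>+z. indicator (?b q) z \<partial>\<mu>)" for q
    by (simp add: sets_mu)
  have [measurable]: "(\<lambda>q. measure \<mu> (?b q)) \<in> borel_measurable (borel \<Otimes>\<^sub>M borel)"
    unfolding measure_def eq by measurable
  show ?thesis
    unfolding gagliardo_kernel_def by measurable
qed

lemma gagliardo_kernel_measurable' [measurable (raw)]:
  assumes "v \<in> borel_measurable borel" "f \<in> borel_measurable M" "g \<in> borel_measurable M"
  shows "(\<lambda>x. gagliardo_kernel v (f x) (g x)) \<in> borel_measurable M"
  using measurable_compose[OF measurable_Pair[OF assms(2,3)] gagliardo_kernel_measurable[OF assms(1)]] by simp

definition truncated_energy :: "'a set \<Rightarrow> ('a \<Rightarrow> real) \<Rightarrow> real \<Rightarrow> ennreal" where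
  "truncated_energy B v R = (\<integral>\<^sup>+x. \<integral>\<^sup>+y. ennreal (gagliardo_kernel v x y) * indicator B x * indicator B y * indicator (ball x R) y \<partial>lborel \<partial>lborel)"

text \<open>\<open>Ap_average\<close> on the ball of radius \<open>4 e r\<close> around \<open>z\<close> brings in \<open>1 / \<mu>\<close> of that ball. The
  ball between \<open>z\<close> and any of its points \<open>y\<close> is contained in it, so that its measure may be
  replaced by the smaller one in the Gagliardo kernel. The powers of \<open>4\<close> compensate the
  normalisation of \<open>local_mean_osc\<close>.\<close>

lemma local_mean_osc_bound:
  assumes [measurable]: "v \<in> borel_measurable borel"
    and fin: "(\<integral>\<^sup>+y\<in>ball x0 r. ennreal \<bar>v y\<bar> \<partial>lborel) < \<infinity>"
    and r: "0 < r" and e: "0 < e"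
  shows "(\<integral>\<^sup>+z\<in>ball x0 r. ennreal (local_mean_osc x0 r e v z powr p) \<partial>\<mu>)
    \<le> ennreal (K * 4 powr (DIM('a) * p)) * truncated_energy (ball x0 r) v (4 * e * r)"
proof -
  let ?B = "ball x0 r" and ?R = "4 * e * r"
  let ?Q = "K * 4 powr (DIM('a) * p)"
  let ?m = "measure lborel (ball x0 (e * r))"
  have R: "?R > 0" using r e by simp
  have m: "?m > 0" using r e by (intro content_ball_pos) auto
  have pt: "ennreal (w z) * (ennreal (local_mean_osc x0 r e v z powr p) * indicator ?B z)
     \<le> ennreal ?Q * (\<integral>\<^sup>+y. ennreal (gagliardo_kernel v z y) * indicator ?B z * indicator ?B y * indicator (ball z ?R) y \<partial>lborel)" for z
  proof (cases "z \<in> ?B")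
    case True
    let ?D = "ball z ?R"
    let ?F = "enn2real (local_osc ?B ?R v z)"
    let ?W = "measure \<mu> ?D"
    have W: "?W > 0" using R by (rule measure_mu_ball_pos)
    have D: "measure lborel ?D powr p = 4 powr (DIM('a) * p) * ?m powr p"
    proof -
      have "measure lborel ?D = measure lborel (ball z (4 * (e * r)))" by (simp add: mult.assoc)
      also have "\<dots> = 4 ^ DIM('a) * ?m" using e r by (intro content_ball_scale) auto
      finally show ?thesis by (simp add: powr_mult powr_powr powr_realpow[symmetric])
    qed
    have F: "ennreal ?F = (\<integral>\<^sup>+y\<in>?D. ennreal (\<bar>v z - v y\<bar> * indicator ?B y) \<partial>lborel)"
      using local_osc_finite(1)[OF assms(1) fin, of ?R z] by (simp add: ennreal_enn2real local_osc_def less_top)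
    have "ennreal (?F powr p * ?W) \<le> ennreal (K * measure lborel ?D powr p)
         * (\<integral>\<^sup>+y\<in>?D. ennreal ((\<bar>v z - v y\<bar> * indicator ?B y) powr p) \<partial>\<mu>)"
      using R F by (intro Ap_average) auto
    also have "(\<integral>\<^sup>+y\<in>?D. ennreal ((\<bar>v z - v y\<bar> * indicator ?B y) powr p) \<partial>\<mu>)
       = (\<integral>\<^sup>+y. ennreal (w y) * (ennreal ((\<bar>v z - v y\<bar> * indicator ?B y) powr p) * indicator ?D y) \<partial>lborel)"
      by (rule nn_integral_mu) measurable
    finally have "ennreal (w z / (?W * ?m powr p)) * ennreal (?F powr p * ?W) 
       \<le> ennreal (w z / (?W * ?m powr p)) * (ennreal (K * measure lborel ?D powr p) *
        (\<integral>\<^sup>+y. ennreal (w y) * (ennreal ((\<bar>v z - v y\<bar> * indicator ?B y) powr p) * indicator ?D y) \<partial>lborel))"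
      (is "_ \<le> _ * (_ * ?I)")
      by (rule mult_left_mono) auto
    also have "ennreal (w z / (?W * ?m powr p)) * ennreal (?F powr p * ?W) = ennreal (w z) * ennreal (local_mean_osc x0 r e v z powr p)"
      using m W w_nonneg[of z] by (simp add: local_mean_osc_def powr_divide ennreal_mult[symmetric])
    also have "ennreal (w z / (?W * ?m powr p)) * (ennreal (K * measure lborel ?D powr p) * ?I) = ennreal ?Q * (ennreal (w z / ?W) * ?I)"
      using m W w_nonneg[of z] K_nonneg
      by (simp add: D mult.assoc[symmetric] ennreal_mult[symmetric]) (simp add: mult_ac)
    also have "ennreal (w z / ?W) * ?I = (\<integral>\<^sup>+y. ennreal (w z / ?W) * (ennreal (w y) * (ennreal ((\<bar>v z - v y\<bar> * indicator ?B y) powr p) * indicator ?D y)) \<partial>lborel)"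
      by (subst nn_integral_cmult) auto
    also have "\<dots> \<le> (\<integral>\<^sup>+y. ennreal (gagliardo_kernel v z y) * indicator ?B z * indicator ?B y * indicator (ball z ?R) y \<partial>lborel)"
    proof (rule nn_integral_mono)
      fix y
      let ?b = "ball ((1/2) *\<^sub>R (z + y)) (norm (z - y) / 2)"
      show "ennreal (w z / ?W) * (ennreal (w y) * (ennreal ((\<bar>v z - v y\<bar> * indicator ?B y) powr p) * indicator ?D y))
         \<le> ennreal (gagliardo_kernel v z y) * indicator ?B z * indicator ?B y * indicator (ball z ?R) y"
      proof (cases "y \<in> ?B \<and> y \<in> ?D \<and> y \<noteq> z")
        case yy: True
        have bpos: "0 < measure \<mu> ?b" using yy by (intro measure_mu_ball_pos) auto
        have "?b \<subseteq> ?D"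
        proof
          fix u assume u: "u \<in> ?b"
          have "z - (1/2) *\<^sub>R (z + y) = (1/2) *\<^sub>R (z - y)"
            by (simp add: algebra_simps) (simp flip: scaleR_add_left)
          then have "dist z ((1/2) *\<^sub>R (z + y)) = norm (z - y) / 2"
            by (simp add: dist_norm)
          then show "u \<in> ?D"
            using u yy dist_triangle[of z u "(1/2) *\<^sub>R (z + y)"] by (simp add: dist_norm)
        qed
        then have "emeasure \<mu> ?b \<le> emeasure \<mu> ?D" by (intro emeasure_mono) (auto simp: sets_mu)
        then have "measure \<mu> ?b \<le> ?W" by (simp add: emeasure_mu_ball)
        then have "\<bar>v z - v y\<bar> powr p * (w z * w y / ?W) \<le> gagliardo_kernel v z y"
          unfolding gagliardo_kernel_def using bpos W w_nonneg[of z] w_nonneg[of y] 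
          by (intro mult_left_mono divide_left_mono) auto
        then show ?thesis
          using yy True W w_nonneg[of z] w_nonneg[of y] 
          by (simp add: ennreal_mult[symmetric] ennreal_leI mult_ac)
      qed (auto split: split_indicator)
    qed
    finally show ?thesis using True K_nonneg by (simp add: mult_left_mono)
  qed simp
  have "(\<integral>\<^sup>+z\<in>?B. ennreal (local_mean_osc x0 r e v z powr p) \<partial>\<mu>)
      = (\<integral>\<^sup>+z. ennreal (w z) * (ennreal (local_mean_osc x0 r e v z powr p) * indicator ?B z) \<partial>lborel)"
    by (rule nn_integral_mu) measurable
  also have "\<dots> \<le> (\<integral>\<^sup>+z. ennreal ?Q * (\<integral>\<^sup>+y. ennreal (gagliardo_kernel v z y) * indicator ?B z * indicator ?B y * indicator (ball z ?R) y \<partial>lborel) \<partial>lborel)"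
    by (intro nn_integral_mono pt)
  also have "\<dots> = ennreal ?Q * truncated_energy ?B v ?R"
    unfolding truncated_energy_def by (subst nn_integral_cmult) auto
  finally show ?thesis .
qed

lemma scale_const_nonneg: "0 \<le> scale_const n p K"
  unfolding scale_const_def using K_nonneg by simp

text \<open>The power mean inequality for the \<open>2 N\<close> summands of \<open>abs_diff_mean_le\<close> loses \<open>2 N\<close> to the
  power \<open>p - 1\<close>, and adding up \<open>2 N\<close> equal bounds loses another factor \<open>2 N\<close>.\<close>

lemma deviation_le_truncated_energy:
  assumes [measurable]: "v \<in> borel_measurable borel"
    and fin: "(\<integral>\<^sup>+y\<in>ball x0 r. ennreal \<bar>v y\<bar> \<partial>lborel) < \<infinity>"
    and r: "0 < r" and N: "0 < N"
    and c: "c = (\<integral>y. v y * indicator (ball x0 r) y \<partial>lborel) / measure lborel (ball x0 r)"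
  shows "(\<integral>\<^sup>+x\<in>ball x0 r. ennreal (\<bar>v x - c\<bar> powr p) \<partial>\<mu>)
    \<le> ennreal (scale_const DIM('a) p K * real N powr p) * truncated_energy (ball x0 r) v (4 * r / real N)"
proof -
  let ?B = "ball x0 r"
  define g where "g = local_mean_osc x0 r (1 / real N) v"
  have [measurable]: "g \<in> borel_measurable borel" unfolding g_def by measurable
  have g0: "0 \<le> g z" for z unfolding g_def by (rule local_mean_osc_nonneg)
  have gfin: "(\<integral>\<^sup>+z\<in>?B. ennreal (g z) \<partial>lborel) < \<infinity>"
    unfolding g_def using N by (intro local_mean_osc_integral_finite assms) auto
  let ?a = "\<lambda>i. contracted_mean ?B g (real i / real N)"
  let ?P = "(2 * real N) powr (p - 1)"
  let ?M = "1 + K\<^sup>2 * 3 powr (DIM('a) * p)"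
  let ?G = "\<integral>\<^sup>+y\<in>?B. ennreal (g y powr p) \<partial>\<mu>"
  have a0: "0 \<le> ?a i x" for i x by (rule contracted_mean_nonneg)
  have pt: "\<bar>v x - c\<bar> powr p \<le> ?P * (\<Sum>i<N. ?a i x powr p + ?a (Suc i) x powr p)" if "x \<in> ?B" for x
  proof -
    have "\<bar>v x - c\<bar> powr p \<le> (\<Sum>i<N. ?a i x + ?a (Suc i) x) powr p"
      using abs_diff_mean_le[OF assms(1) fin r N that c] p by (intro powr_mono2) (auto simp: g_def)
    also have "\<dots> \<le> real (card {..<N}) powr (p - 1) * (\<Sum>i<N. (?a i x + ?a (Suc i) x) powr p)"
      using p a0 by (intro sum_powr_le) (auto intro!: add_nonneg_nonneg contracted_mean_nonneg)
    also have "\<dots> \<le> real N powr (p - 1) * (\<Sum>i<N. 2 powr (p - 1) * (?a i x powr p + ?a (Suc i) x powr p))"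
      using p a0 by (auto intro!: mult_left_mono sum_mono add_powr_le contracted_mean_nonneg)
    also have "\<dots> = ?P * (\<Sum>i<N. ?a i x powr p + ?a (Suc i) x powr p)"
      by (simp add: powr_mult sum_distrib_left mult_ac)
    finally show ?thesis .
  qed
  have bound: "(\<integral>\<^sup>+x\<in>?B. ennreal (?a i x powr p) \<partial>\<mu>) \<le> ennreal ?M * ?G" if "i \<le> N" for i
    using that N by (intro contracted_mean_bound g0 gfin r) auto
  have "(\<integral>\<^sup>+x\<in>?B. ennreal (\<bar>v x - c\<bar> powr p) \<partial>\<mu>)
    \<le> (\<integral>\<^sup>+x. ennreal ?P * (\<Sum>i<N. ennreal (?a i x powr p) * indicator ?B x + ennreal (?a (Suc i) x powr p) * indicator ?B x) \<partial>\<mu>)"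
  proof (rule nn_integral_mono)
    fix x
    show "ennreal (\<bar>v x - c\<bar> powr p) * indicator ?B x \<le> ennreal ?P * (\<Sum>i<N. ennreal (?a i x powr p) * indicator ?B x + ennreal (?a (Suc i) x powr p) * indicator ?B x)"
    proof (cases "x \<in> ?B")
      case True
      have "ennreal (\<bar>v x - c\<bar> powr p) \<le> ennreal (?P * (\<Sum>i<N. ?a i x powr p + ?a (Suc i) x powr p))"
        by (intro ennreal_leI pt True)
      also have "\<dots> = ennreal ?P * (\<Sum>i<N. ennreal (?a i x powr p) + ennreal (?a (Suc i) x powr p))"
        by (subst ennreal_mult) (auto intro!: sum_nonneg simp flip: sum_ennreal ennreal_plus)
      finally show ?thesis using True by simp
    qed simp
  qed
  also have "\<dots> = ennreal ?P * (\<Sum>i<N. (\<integral>\<^sup>+x\<in>?B. ennreal (?a i x powr p) \<partial>\<mu>) + (\<integral>\<^sup>+x\<in>?B. ennreal (?a (Suc i) x powr p) \<partial>\<mu>))"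
    by (subst nn_integral_cmult; (subst nn_integral_sum; (subst nn_integral_add)?)?) auto
  also have "\<dots> \<le> ennreal ?P * (\<Sum>i<N. ennreal ?M * ?G + ennreal ?M * ?G)"
    by (intro mult_left_mono sum_mono add_mono bound) auto
  also have "\<dots> = ennreal ?P * (ennreal (2 * real N) * (ennreal ?M * ?G))"
    by (simp add: ennreal_mult mult_ac flip: mult_2 ennreal_of_nat_eq_real_of_nat)
  also have "\<dots> \<le> ennreal ?P * (ennreal (2 * real N) * (ennreal ?M * (ennreal (K * 4 powr (DIM('a) * p)) * truncated_energy ?B v (4 * (1 / real N) * r))))"
    unfolding g_def using N by (intro mult_left_mono local_mean_osc_bound assms) auto
  also have "\<dots> = ennreal (?P * (2 * real N) * ?M * (K * 4 powr (DIM('a) * p))) * truncated_energy ?B v (4 * r / real N)"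
    using K_nonneg by (simp add: ennreal_mult mult.assoc)
  also have "?P * (2 * real N) * ?M * (K * 4 powr (DIM('a) * p)) = scale_const DIM('a) p K * real N powr p"
    using N by (simp add: scale_const_def powr_diff powr_mult)
  finally show ?thesis .
qed

end

section \<open>Summation over dyadic scales\<close>

text \<open>The increments of \<open>k \<mapsto> 2\<close> to the power \<open>k a\<close>, with the value \<open>1\<close> at \<open>k = 0\<close>. Taking
  increments rather than the powers themselves keeps the constants bounded as \<open>a\<close> tends to \<open>0\<close>.\<close>

definition dyadic_weight :: "real \<Rightarrow> nat \<Rightarrow> real" where
  "dyadic_weight a k = (if k = 0 then 1 else 2 powr (real k * a) - 2 powr (real (k - 1) * a))"

lemma dyadic_weight_nonneg: "0 \<le> a \<Longrightarrow> 0 \<le> dyadic_weight a k"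
  by (auto simp: dyadic_weight_def intro!: powr_mono mult_right_mono)

text \<open>The scales with \<open>2\<^sup>k < X\<close> form an initial segment, so that the increments telescope to the
  last power, which is at most that of \<open>X\<close>.\<close>

lemma sum_dyadic_weight_le:
  assumes a: "0 \<le> a" and X: "0 < X"
  shows "(\<Sum>k<M. if 2 ^ k < X then dyadic_weight a k else 0) \<le> X powr a"
proof -
  let ?S = "\<lambda>M. \<Sum>k<M. if 2 ^ k < X then dyadic_weight a k else 0"
  have "?S M \<le> X powr a \<and> (0 < M \<longrightarrow> ?S M \<le> 2 powr (real (M - 1) * a))"
  proof (induction M)
    case (Suc M)
    have step: "?S (Suc M) \<le> 2 powr (real M * a)"
    proof (cases "M = 0")
      case False
      have "2 powr (real (M - 1) * a) \<le> 2 powr (real M * a)"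
        using a by (intro powr_mono mult_right_mono) auto
      moreover have "?S M \<le> 2 powr (real (M - 1) * a)"
        using Suc False by simp
      moreover have "?S (Suc M) = (if 2 ^ M < X then ?S M + (2 powr (real M * a) - 2 powr (real (M - 1) * a)) else ?S M)"
        using False by (simp add: dyadic_weight_def)
      ultimately show ?thesis by argo
    qed (auto simp: dyadic_weight_def)
    have "?S (Suc M) \<le> X powr a"
    proof (cases "2 ^ M < X")
      case True
      have "2 powr (real M * a) = (2 ^ M) powr a"
        by (simp add: powr_realpow[symmetric] powr_powr)
      also have "\<dots> \<le> X powr a"
        using True a by (intro powr_mono2) auto
      finally show ?thesis using step by simp
    qed (use Suc in auto)
    with step show ?case by simp
  qed simp
  then show ?thesis by simp
qed

text \<open>Each term with \<open>k > 0\<close> is a difference of consecutive powers of \<open>q\<close>, the earlier one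
  multiplied by \<open>2\<close> to the power \<open>- p\<close>, so that the sum equals \<open>1 - 2\<close> to the power \<open>- p\<close> times
  the geometric sum, up to a nonnegative boundary term. This factor is at least \<open>1 / 2\<close>.\<close>

lemma sum_dyadic_weight_ge:
  fixes a p :: real
  assumes p: "1 \<le> p"
  defines "q \<equiv> 2 powr (a - p)"
  shows "(\<Sum>k<M. q ^ k) / 2 \<le> (\<Sum>k<M. dyadic_weight a k * 2 powr (- real k * p))"
proof -
  have term_eq: "dyadic_weight a (Suc k) * 2 powr (- real (Suc k) * p) = q ^ Suc k - 2 powr (- p) * q ^ k" for k
    by (simp add: dyadic_weight_def q_def powr_power left_diff_distrib del: of_nat_Suc flip: powr_add)
       (simp add: algebra_simps)
  have "(\<Sum>k<Suc m. dyadic_weight a k * 2 powr (- real k * p))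
      = (1 - 2 powr (- p)) * (\<Sum>k<Suc m. q ^ k) + 2 powr (- p) * q ^ m" for m
  proof (induction m)
    case 0
    show ?case by (simp add: dyadic_weight_def)
  next
    case (Suc m)
    then show ?case
      by (subst sum.lessThan_Suc, subst term_eq) (simp add: algebra_simps)
  qed
  note eq = this
  have "2 powr (- p) \<le> (2::real) powr (- 1)" using p by (intro powr_mono) auto
  then have half: "1 / 2 \<le> 1 - 2 powr (- p)" by (simp add: powr_minus)
  have q0: "0 \<le> q" by (simp add: q_def)
  show ?thesis
  proof (cases M)
    case (Suc m)
    have "1 / 2 * (\<Sum>k<Suc m. q ^ k) \<le> (1 - 2 powr (- p)) * (\<Sum>k<Suc m. q ^ k)"
      using half q0 by (intro mult_right_mono sum_nonneg) auto
    also have "\<dots> \<le> (1 - 2 powr (- p)) * (\<Sum>k<Suc m. q ^ k) + 2 powr (- p) * q ^ m"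
      using q0 by simp
    finally show ?thesis unfolding Suc eq by simp
  qed simp
qed

lemma one_minus_two_powr_le:
  assumes "0 \<le> x"
  shows "1 - 2 powr (- x) \<le> (x::real)"
proof -
  have "ln 2 \<le> (1::real)" using ln_le_minus_one[of "2::real"] by simp
  then have "x * ln 2 \<le> x * 1" using assms by (intro mult_left_mono)
  moreover have "1 + - x * ln 2 \<le> exp (- x * ln 2)" by (rule exp_ge_add_one_self)
  ultimately show ?thesis by (simp add: powr_def)
qed

definition poincare_const :: "nat \<Rightarrow> real \<Rightarrow> real \<Rightarrow> real" where
  "poincare_const n p K = 2 * p * 4 powr p * scale_const n p K"

context Ap_weight
begin

text \<open>The outer integral runs over the first argument of the kernel; as the kernel is symmetric,
  this agrees with \<open>gagliardo\<close>, where it runs over the second.\<close>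

definition gagliardo_energy :: "real \<Rightarrow> 'a set \<Rightarrow> ('a \<Rightarrow> real) \<Rightarrow> ennreal" where
  "gagliardo_energy s B v = (\<integral>\<^sup>+x. \<integral>\<^sup>+y. ennreal (gagliardo_kernel v x y / norm (x - y) powr (s * p)) * indicator B x * indicator B y \<partial>lborel \<partial>lborel)"

text \<open>For a fixed pair, \<open>y\<close> is within \<open>4 r / 2\<^sup>k\<close> of \<open>x\<close> exactly if \<open>2\<^sup>k < X\<close> for
  \<open>X = 4 r / |x - y|\<close>, so that the weights of the scales that see the pair sum to at most \<open>X\<close> to
  the power \<open>s p\<close>. On the diagonal the kernel vanishes.\<close>

lemma sum_truncated_energy_le:
  assumes [measurable]: "v \<in> borel_measurable borel" "B \<in> sets borel"
    and s: "0 \<le> s" and r: "0 < r"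
  shows "(\<Sum>k<M. ennreal (dyadic_weight (s * p) k) * truncated_energy B v (4 * r / 2 ^ k))
    \<le> ennreal ((4 * r) powr (s * p)) * gagliardo_energy s B v"
proof -
  have sp: "0 \<le> s * p" using s p by simp
  let ?b = "dyadic_weight (s * p)"
  let ?e = "\<lambda>k x y. ennreal (gagliardo_kernel v x y) * indicator B x * indicator B y * indicator (ball x (4 * r / 2 ^ k)) y"
  have "(\<Sum>k<M. ennreal (?b k) * truncated_energy B v (4 * r / 2 ^ k))
    = (\<Sum>k<M. (\<integral>\<^sup>+x. \<integral>\<^sup>+y. ennreal (?b k) * ?e k x y \<partial>lborel \<partial>lborel))"
    unfolding truncated_energy_def by (intro sum.cong refl) (subst nn_integral_cmult; (subst nn_integral_cmult)?; measurable)
  also have "\<dots> = (\<integral>\<^sup>+x. \<integral>\<^sup>+y. (\<Sum>k<M. ennreal (?b k) * ?e k x y) \<partial>lborel \<partial>lborel)"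
    by (subst nn_integral_sum; (subst nn_integral_sum)?; measurable)
  also have "\<dots> \<le> (\<integral>\<^sup>+x. \<integral>\<^sup>+y. ennreal ((4 * r) powr (s * p)) * (ennreal (gagliardo_kernel v x y / norm (x - y) powr (s * p)) * indicator B x * indicator B y) \<partial>lborel \<partial>lborel)"
  proof (intro nn_integral_mono)
    fix x y
    show "(\<Sum>k<M. ennreal (?b k) * ?e k x y) \<le> ennreal ((4 * r) powr (s * p)) * (ennreal (gagliardo_kernel v x y / norm (x - y) powr (s * p)) * indicator B x * indicator B y)"
    proof (cases "x \<in> B \<and> y \<in> B \<and> x \<noteq> y")
      case True
      define X where "X = 4 * r / norm (x - y)"
      have X: "X > 0" using True r by (simp add: X_def)
      have "(\<Sum>k<M. ennreal (?b k) * ?e k x y) = (\<Sum>k<M. ennreal ((if 2 ^ k < X then ?b k else 0) * gagliardo_kernel v x y))"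
      proof (rule sum.cong)
        fix k
        have "y \<in> ball x (4 * r / 2 ^ k) \<longleftrightarrow> 2 ^ k < X"
          using True r by (simp add: X_def dist_norm field_simps)
        then show "ennreal (?b k) * ?e k x y = ennreal ((if 2 ^ k < X then ?b k else 0) * gagliardo_kernel v x y)"
          using True by (simp add: ennreal_mult gagliardo_kernel_nonneg dyadic_weight_nonneg[OF sp] split: split_indicator)
      qed simp
      also have "\<dots> = ennreal ((\<Sum>k<M. if 2 ^ k < X then ?b k else 0) * gagliardo_kernel v x y)"
        by (subst sum_ennreal) (auto simp: sum_distrib_right gagliardo_kernel_nonneg dyadic_weight_nonneg[OF sp])
      also have "\<dots> \<le> ennreal (X powr (s * p) * gagliardo_kernel v x y)"
        using sum_dyadic_weight_le[OF sp X] gagliardo_kernel_nonneg by (intro ennreal_leI mult_right_mono) auto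
      also have "X powr (s * p) * gagliardo_kernel v x y = (4 * r) powr (s * p) * (gagliardo_kernel v x y / norm (x - y) powr (s * p))"
        using r by (simp add: X_def powr_divide)
      finally show ?thesis using True gagliardo_kernel_nonneg[of v x y] by (simp flip: ennreal_mult)
    next
      case False
      have "x = y \<Longrightarrow> gagliardo_kernel v x y = 0" by (simp add: gagliardo_kernel_def)
      then have "?e k x y = 0" for k using False by (auto split: split_indicator)
      then show ?thesis by (simp only: mult_zero_right sum.neutral_const zero_le)
    qed
  qed
  also have "\<dots> = ennreal ((4 * r) powr (s * p)) * gagliardo_energy s B v"
    unfolding gagliardo_energy_def by (subst nn_integral_cmult; (subst nn_integral_cmult)?; measurable)
  finally show ?thesis .
qed

text \<open>The scale inequalities are combined with the coefficients \<open>dyadic_weight (s * p) k\<close>, divided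
  by \<open>2\<close> to the power \<open>k p\<close>. The coefficients on the left-hand side sum to at least half a
  geometric sum with ratio \<open>q\<close>, where \<open>1 - q\<close> is at most \<open>p (1 - s)\<close>; this is where the factor
  \<open>1 - s\<close> arises.\<close>

theorem fractional_poincare:
  assumes [measurable]: "v \<in> borel_measurable borel"
    and fin: "(\<integral>\<^sup>+y\<in>ball x0 r. ennreal \<bar>v y\<bar> \<partial>lborel) < \<infinity>"
    and r: "0 < r" and s: "0 < s" "s < 1"
    and c: "c = (\<integral>y. v y * indicator (ball x0 r) y \<partial>lborel) / measure lborel (ball x0 r)"
  shows "(\<integral>\<^sup>+x\<in>ball x0 r. ennreal (\<bar>v x - c\<bar> powr p) \<partial>\<mu>)
    \<le> ennreal (poincare_const DIM('a) p K * (1 - s) * r powr (s * p)) * gagliardo_energy s (ball x0 r) v"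
\<comment> \<open>If the constant vanishes then the right-hand side is \<open>0\<close> even for infinite energy, since
  \<open>0 * \<infinity> = 0\<close>; that case is covered by the main argument.\<close>
proof (cases "gagliardo_energy s (ball x0 r) v = \<infinity> \<and> scale_const DIM('a) p K \<noteq> 0")
  case True
  then have "0 < poincare_const DIM('a) p K * (1 - s) * r powr (s * p)"
    using p s r scale_const_nonneg[of "DIM('a)"] unfolding poincare_const_def
    by (intro mult_pos_pos) (auto simp: less_le)
  moreover have "ennreal k * top = top" if "0 < k" for k
    using that by (simp add: ennreal_mult_top)
  ultimately show ?thesis using True by (metis infinity_ennreal_def top_greatest)
next
  case False
  let ?B = "ball x0 r" and ?A = "scale_const DIM('a) p K"
  let ?b = "dyadic_weight (s * p)"
  define D where "D = (\<integral>\<^sup>+x\<in>?B. ennreal (\<bar>v x - c\<bar> powr p) \<partial>\<mu>)"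
  define q where "q = 2 powr (s * p - p)"
  have D: "D \<le> ennreal (?A * 2 powr (real k * p)) * truncated_energy ?B v (4 * r / 2 ^ k)" for k
    using deviation_le_truncated_energy[OF assms(1) fin r, of "2 ^ k" c] c
    by (simp add: D_def powr_realpow[symmetric] powr_powr)
  have sp: "0 \<le> s * p" using s p by simp
  have sum_le: "ennreal ((\<Sum>k<M. q ^ k) / 2) * D \<le> ennreal (?A * (4 * r) powr (s * p)) * gagliardo_energy s ?B v" for M
  proof -
    have "ennreal ((\<Sum>k<M. q ^ k) / 2) * D \<le> ennreal (\<Sum>k<M. ?b k * 2 powr (- real k * p)) * D"
      using p unfolding q_def by (intro mult_right_mono ennreal_leI sum_dyadic_weight_ge) auto
    also have "\<dots> = (\<Sum>k<M. ennreal (?b k * 2 powr (- real k * p)) * D)"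
      by (simp add: dyadic_weight_nonneg[OF sp] flip: sum_distrib_right)
    also have "\<dots> \<le> (\<Sum>k<M. ennreal (?b k * 2 powr (- real k * p)) * (ennreal (?A * 2 powr (real k * p)) * truncated_energy ?B v (4 * r / 2 ^ k)))"
      by (intro sum_mono mult_left_mono D) auto
    also have "\<dots> = ennreal ?A * (\<Sum>k<M. ennreal (?b k) * truncated_energy ?B v (4 * r / 2 ^ k))"
      unfolding sum_distrib_left
    proof (intro sum.cong refl)
      fix k
      have "?b k * 2 powr (- real k * p) * (?A * 2 powr (real k * p)) = ?A * ?b k"
        by (simp add: powr_minus)
      then have "ennreal (?b k * 2 powr (- real k * p)) * ennreal (?A * 2 powr (real k * p)) = ennreal ?A * ennreal (?b k)"
        using scale_const_nonneg dyadic_weight_nonneg[OF sp, of k] by (simp flip: ennreal_mult)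
      then show "ennreal (?b k * 2 powr (- real k * p)) * (ennreal (?A * 2 powr (real k * p)) * truncated_energy ?B v (4 * r / 2 ^ k))
         = ennreal ?A * (ennreal (?b k) * truncated_energy ?B v (4 * r / 2 ^ k))"
        by (simp add: mult.assoc[symmetric])
    qed
    also have "\<dots> \<le> ennreal ?A * (ennreal ((4 * r) powr (s * p)) * gagliardo_energy s ?B v)"
      using s r by (intro mult_left_mono sum_truncated_energy_le) auto
    also have "\<dots> = ennreal (?A * (4 * r) powr (s * p)) * gagliardo_energy s ?B v"
      using scale_const_nonneg by (simp add: ennreal_mult mult.assoc)
    finally show ?thesis .
  qed
  define R where "R = ennreal (?A * (4 * r) powr (s * p)) * gagliardo_energy s ?B v"
  have Rfin: "R < \<infinity>"
    using False by (auto simp: R_def ennreal_mult_less_top less_top)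
  have "ennreal (1 / 2) * D \<le> R"
    using sum_le[of 1] by (simp add: R_def)
  with Rfin have Dfin: "D < \<infinity>"
    by (cases "D = \<infinity>") (auto simp: ennreal_mult_top less_top top_unique)
  obtain d where d: "D = ennreal d" "0 \<le> d" using Dfin by (cases D) auto
  obtain \<rho> where \<rho>: "R = ennreal \<rho>" "0 \<le> \<rho>" using Rfin by (cases R) auto
  have x: "0 < p * (1 - s)" using p s by simp
  have qx: "q = 2 powr (- (p * (1 - s)))" by (simp add: q_def algebra_simps)
  have q01: "0 \<le> q" "q < 1"
    using x unfolding qx by (auto intro: powr_less_one)
  have "(\<Sum>k<M. q ^ k) * (d / 2) \<le> \<rho>" for M
  proof -
    have "ennreal ((\<Sum>k<M. q ^ k) / 2 * d) \<le> ennreal \<rho>"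
      using sum_le[of M] d \<rho> q01 unfolding R_def[symmetric] by (subst ennreal_mult) (auto intro!: sum_nonneg)
    then show ?thesis using \<rho> by simp
  qed
  moreover have "(\<lambda>M. (\<Sum>k<M. q ^ k) * (d / 2)) \<longlonglongrightarrow> 1 / (1 - q) * (d / 2)"
    using geometric_sums[of q] q01 by (intro tendsto_mult_right) (auto simp: sums_def)
  ultimately have "1 / (1 - q) * (d / 2) \<le> \<rho>"
    by (intro LIMSEQ_le_const2) auto
  then have "d \<le> (1 - q) * (2 * \<rho>)"
    using q01 by (simp add: field_simps)
  also have "\<dots> \<le> p * (1 - s) * (2 * \<rho>)"
    using one_minus_two_powr_le[of "p * (1 - s)"] x \<rho>(2) unfolding qx by (intro mult_right_mono) auto
  finally have "D \<le> ennreal (2 * p * (1 - s)) * R"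
    using d \<rho> p s by (simp add: ennreal_leI mult_ac flip: ennreal_mult)
  also have "\<dots> = ennreal (2 * p * (1 - s) * ?A * (4 * r) powr (s * p)) * gagliardo_energy s ?B v"
    using p s scale_const_nonneg by (simp add: R_def ennreal_mult mult.assoc)
  also have "\<dots> \<le> ennreal (poincare_const DIM('a) p K * (1 - s) * r powr (s * p)) * gagliardo_energy s ?B v"
  proof (intro mult_right_mono ennreal_leI)
    have "4 powr (s * p) \<le> 4 powr (p :: real)" using s p by (intro powr_mono) auto
    then have "2 * p * (1 - s) * ?A * r powr (s * p) * 4 powr (s * p) \<le> 2 * p * (1 - s) * ?A * r powr (s * p) * 4 powr p"
      using p s scale_const_nonneg by (intro mult_left_mono) auto
    moreover have "(4 * r) powr (s * p) = 4 powr (s * p) * r powr (s * p)"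
      using r by (simp add: powr_mult)
    ultimately show "2 * p * (1 - s) * ?A * (4 * r) powr (s * p) \<le> poincare_const DIM('a) p K * (1 - s) * r powr (s * p)"
      by (simp only: poincare_const_def mult_ac)
  qed simp
  finally show ?thesis unfolding D_def .
qed

text \<open>The hypothesis says that the constant function \<open>c - m\<close> is controlled in \<open>L\<^sup>p(\<mu>)\<close> by \<open>v - c\<close>,
  whence the triangle inequality allows \<open>c\<close> to be exchanged for \<open>m\<close>.\<close>

lemma deviation_other_mean:
  assumes [measurable]: "v \<in> borel_measurable borel"
    and A: "0 \<le> A"
    and close: "ennreal (\<bar>c - m\<bar> powr p * measure \<mu> (ball x0 r)) \<le> ennreal A * (\<integral>\<^sup>+x\<in>ball x0 r. ennreal (\<bar>v x - c\<bar> powr p) \<partial>\<mu>)"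
  shows "(\<integral>\<^sup>+x\<in>ball x0 r. ennreal (\<bar>v x - m\<bar> powr p) \<partial>\<mu>)
    \<le> ennreal (2 powr (p - 1) * (1 + A)) * (\<integral>\<^sup>+x\<in>ball x0 r. ennreal (\<bar>v x - c\<bar> powr p) \<partial>\<mu>)"
proof -
  let ?B = "ball x0 r"
  let ?D = "\<integral>\<^sup>+x\<in>?B. ennreal (\<bar>v x - c\<bar> powr p) \<partial>\<mu>"
  have "(\<integral>\<^sup>+x\<in>?B. ennreal (\<bar>v x - m\<bar> powr p) \<partial>\<mu>)
    \<le> (\<integral>\<^sup>+x. ennreal (2 powr (p - 1)) * (ennreal (\<bar>v x - c\<bar> powr p) * indicator ?B x + ennreal (\<bar>c - m\<bar> powr p) * indicator ?B x) \<partial>\<mu>)"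
  proof (rule nn_integral_mono)
    fix x
    have "\<bar>v x - m\<bar> powr p \<le> (\<bar>v x - c\<bar> + \<bar>c - m\<bar>) powr p"
      using p by (intro powr_mono2) auto
    also have "\<dots> \<le> 2 powr (p - 1) * (\<bar>v x - c\<bar> powr p + \<bar>c - m\<bar> powr p)"
      using p by (intro add_powr_le) auto
    finally show "ennreal (\<bar>v x - m\<bar> powr p) * indicator ?B x \<le> ennreal (2 powr (p - 1)) * (ennreal (\<bar>v x - c\<bar> powr p) * indicator ?B x + ennreal (\<bar>c - m\<bar> powr p) * indicator ?B x)"
      by (auto split: split_indicator simp: ennreal_leI simp flip: ennreal_mult ennreal_plus)
  qed
  also have "\<dots> = ennreal (2 powr (p - 1)) * (?D + ennreal (\<bar>c - m\<bar> powr p) * emeasure \<mu> ?B)"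
    by (subst nn_integral_cmult; (subst nn_integral_add)?) (auto simp: nn_integral_cmult_indicator sets_mu)
  also have "ennreal (\<bar>c - m\<bar> powr p) * emeasure \<mu> ?B = ennreal (\<bar>c - m\<bar> powr p * measure \<mu> ?B)"
    by (simp add: emeasure_mu_ball ennreal_mult)
  also have "ennreal (2 powr (p - 1)) * (?D + \<dots>) \<le> ennreal (2 powr (p - 1)) * (?D + ennreal A * ?D)"
    by (intro mult_left_mono add_left_mono close) auto
  also have "\<dots> = ennreal (2 powr (p - 1) * (1 + A)) * ?D"
    using A by (simp add: ennreal_mult distrib_left distrib_right mult.assoc)
  finally show ?thesis .
qed

text \<open>By Hoelder's inequality for \<open>\<mu>\<close> on the ball, \<open>c - m\<close> is controlled with constant \<open>1\<close>.
  Finiteness of the deviation from \<open>c\<close> guarantees that \<open>v w\<close> is integrable; otherwise the integral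
  defining \<open>m\<close> would be the default value \<open>0\<close>.\<close>

lemma deviation_weighted_mean:
  assumes [measurable]: "v \<in> borel_measurable borel"
    and r: "0 < r"
    and fin: "(\<integral>\<^sup>+x\<in>ball x0 r. ennreal (\<bar>v x - c\<bar> powr p) \<partial>\<mu>) < \<infinity>"
    and m: "m = (\<integral>x. v x * (w x / measure \<mu> (ball x0 r)) * indicator (ball x0 r) x \<partial>lborel)"
  shows "(\<integral>\<^sup>+x\<in>ball x0 r. ennreal (\<bar>v x - m\<bar> powr p) \<partial>\<mu>)
    \<le> ennreal (2 powr p) * (\<integral>\<^sup>+x\<in>ball x0 r. ennreal (\<bar>v x - c\<bar> powr p) \<partial>\<mu>)"
proof -
  let ?B = "ball x0 r"
  let ?W = "measure \<mu> ?B"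
  let ?D = "\<integral>\<^sup>+x\<in>?B. ennreal (\<bar>v x - c\<bar> powr p) \<partial>\<mu>"
  have W: "0 < ?W" using r by (rule measure_mu_ball_pos)
  define F where "F = (\<integral>\<^sup>+x\<in>?B. ennreal \<bar>v x - c\<bar> \<partial>\<mu>)"
  have F_lborel: "F = (\<integral>\<^sup>+x. ennreal (w x) * (ennreal \<bar>v x - c\<bar> * indicator ?B x) \<partial>lborel)"
    unfolding F_def by (rule nn_integral_mu) measurable
  have W_lborel: "emeasure \<mu> ?B = (\<integral>\<^sup>+x. ennreal (w x) * indicator ?B x \<partial>lborel)"
    unfolding weighted_def by (subst emeasure_density) auto
  have "F \<le> (\<integral>\<^sup>+x. indicator ?B x + ennreal (\<bar>v x - c\<bar> powr p) * indicator ?B x \<partial>\<mu>)"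
    unfolding F_def
  proof (rule nn_integral_mono)
    fix x
    have "ennreal \<bar>v x - c\<bar> \<le> ennreal (1 + \<bar>v x - c\<bar> powr p)"
      by (intro ennreal_leI abs_le_one_plus_powr p)
    then show "ennreal \<bar>v x - c\<bar> * indicator ?B x \<le> indicator ?B x + ennreal (\<bar>v x - c\<bar> powr p) * indicator ?B x"
      by (auto split: split_indicator)
  qed
  also have "\<dots> = emeasure \<mu> ?B + ?D"
    by (subst nn_integral_add) (auto simp: sets_mu)
  also have "\<dots> < \<infinity>"
    using fin finite_on_balls[of x0 r] by (simp add: less_top)
  finally have Ffin: "F < \<infinity>" .
  then have Fr: "F = ennreal (enn2real F)" by (simp add: less_top)
  have int1: "integrable lborel (\<lambda>x. (v x - c) * w x * indicator ?B x)"
    using Ffin unfolding F_lborel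
    by (intro integrableI_bounded) (auto simp: abs_mult ennreal_mult ennreal_indicator w_nonneg mult_ac)
  have int2: "integrable lborel (\<lambda>x. w x * indicator ?B x)"
    using finite_on_balls[of x0 r] unfolding W_lborel
    by (intro integrableI_bounded) (auto simp: abs_mult ennreal_mult ennreal_indicator w_nonneg)
  have int2_eq: "(\<integral>x. w x * indicator ?B x \<partial>lborel) = ?W"
    unfolding measure_def W_lborel
    by (subst integral_eq_nn_integral) (auto simp: w_nonneg ennreal_mult ennreal_indicator)
  have "m = (\<integral>x. ((v x - c) * w x * indicator ?B x) / ?W + c / ?W * (w x * indicator ?B x) \<partial>lborel)"
    unfolding m by (intro Bochner_Integration.integral_cong)
      (auto simp: diff_divide_distrib left_diff_distrib split: split_indicator)
  also have "\<dots> = (\<integral>x. (v x - c) * w x * indicator ?B x \<partial>lborel) / ?W + c"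
    using int1 int2 W by (subst Bochner_Integration.integral_add) (auto simp: int2_eq)
  finally have "(c - m) * ?W = - (\<integral>x. (v x - c) * w x * indicator ?B x \<partial>lborel)"
    using W by (simp add: field_simps)
  then have "\<bar>c - m\<bar> * ?W = norm (\<integral>x. (v x - c) * w x * indicator ?B x \<partial>lborel)"
    using W by (metis abs_minus_cancel abs_mult abs_of_pos real_norm_def)
  then have "ennreal (\<bar>c - m\<bar> * ?W) \<le> (\<integral>\<^sup>+x. ennreal (norm ((v x - c) * w x * indicator ?B x)) \<partial>lborel)"
    using integral_norm_bound_ennreal[OF int1] by simp
  also have "\<dots> = F"
    unfolding F_lborel by (intro nn_integral_cong) (auto simp: abs_mult ennreal_mult ennreal_indicator w_nonneg mult_ac)
  finally have le_F: "ennreal (\<bar>c - m\<bar> * ?W) \<le> F" .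
  have "ennreal ((\<bar>c - m\<bar> * ?W) powr p) \<le> ennreal (?W powr (p - 1)) * (\<integral>\<^sup>+x. ennreal ((\<bar>v x - c\<bar> * indicator ?B x) powr p) \<partial>\<mu>)"
  proof (rule holder_powr[where g = "indicator ?B"])
    have "(\<integral>\<^sup>+x. ennreal (indicator ?B x powr (p / (p - 1))) \<partial>\<mu>) = (\<integral>\<^sup>+x. indicator ?B x \<partial>\<mu>)"
      by (intro nn_integral_cong) (auto split: split_indicator)
    then show "(\<integral>\<^sup>+x. ennreal (indicator ?B x powr (p / (p - 1))) \<partial>\<mu>) \<le> ennreal ?W"
      by (simp add: sets_mu emeasure_mu_ball)
    have "F = (\<integral>\<^sup>+x. ennreal (\<bar>v x - c\<bar> * indicator ?B x * indicator ?B x) \<partial>\<mu>)"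
      unfolding F_def by (intro nn_integral_cong) (auto split: split_indicator)
    then show "ennreal (\<bar>c - m\<bar> * ?W) \<le> (\<integral>\<^sup>+x. ennreal (\<bar>v x - c\<bar> * indicator ?B x * indicator ?B x) \<partial>\<mu>)"
      using le_F by simp
  qed (use W p in \<open>auto intro!: borel_measurable_indicator simp: sets_mu\<close>)
  also have "(\<integral>\<^sup>+x. ennreal ((\<bar>v x - c\<bar> * indicator ?B x) powr p) \<partial>\<mu>) = ?D"
    by (intro nn_integral_cong) (auto split: split_indicator)
  finally have "ennreal (1 / ?W powr (p - 1)) * ennreal ((\<bar>c - m\<bar> * ?W) powr p)
      \<le> ennreal (1 / ?W powr (p - 1)) * (ennreal (?W powr (p - 1)) * ?D)"
    by (rule mult_left_mono) simp
  also have "\<dots> = ennreal 1 * ?D"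
    using W by (simp add: mult.assoc[symmetric] flip: ennreal_mult)
  also have "ennreal (1 / ?W powr (p - 1)) * ennreal ((\<bar>c - m\<bar> * ?W) powr p) = ennreal (\<bar>c - m\<bar> powr p * ?W)"
    using W by (simp add: powr_mult powr_diff flip: ennreal_mult)
  finally have "(\<integral>\<^sup>+x\<in>?B. ennreal (\<bar>v x - m\<bar> powr p) \<partial>\<mu>) \<le> ennreal (2 powr (p - 1) * (1 + 1)) * ?D"
    by (intro deviation_other_mean) auto
  then show ?thesis by (simp add: powr_diff)
qed

text \<open>Here \<open>c - m\<close> is controlled by the Lebesgue mean of \<open>|v - c|\<close>, which \<open>Ap_average\<close> converts
  into a \<open>\<mu>\<close>-mean.\<close>

lemma deviation_bounded_mean:
  assumes [measurable]: "v \<in> borel_measurable borel"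
    and r: "0 < r" and c0: "0 \<le> c0"
    and fin: "(\<integral>\<^sup>+x\<in>ball x0 r. ennreal \<bar>v x\<bar> \<partial>lborel) < \<infinity>"
    and close: "ennreal \<bar>c - m\<bar> \<le> ennreal (c0 / measure lborel (ball x0 r)) * (\<integral>\<^sup>+x\<in>ball x0 r. ennreal \<bar>v x - c\<bar> \<partial>lborel)"
  shows "(\<integral>\<^sup>+x\<in>ball x0 r. ennreal (\<bar>v x - m\<bar> powr p) \<partial>\<mu>)
    \<le> ennreal (2 powr (p - 1) * (1 + c0 powr p * K)) * (\<integral>\<^sup>+x\<in>ball x0 r. ennreal (\<bar>v x - c\<bar> powr p) \<partial>\<mu>)"
proof (rule deviation_other_mean)
  let ?B = "ball x0 r"
  let ?b = "measure lborel ?B" and ?W = "measure \<mu> ?B"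
  let ?D = "\<integral>\<^sup>+x\<in>?B. ennreal (\<bar>v x - c\<bar> powr p) \<partial>\<mu>"
  define F where "F = (\<integral>\<^sup>+x\<in>?B. ennreal \<bar>v x - c\<bar> \<partial>lborel)"
  have b: "0 < ?b" using r by (rule content_ball_pos)
  have "F \<le> (\<integral>\<^sup>+x. ennreal \<bar>v x\<bar> * indicator ?B x + ennreal \<bar>c\<bar> * indicator ?B x \<partial>lborel)"
    unfolding F_def by (intro nn_integral_mono) (auto split: split_indicator intro!: ennreal_leI simp flip: ennreal_plus)
  also have "\<dots> = (\<integral>\<^sup>+x\<in>?B. ennreal \<bar>v x\<bar> \<partial>lborel) + ennreal \<bar>c\<bar> * emeasure lborel ?B"
    by (subst nn_integral_add) (auto simp: nn_integral_cmult_indicator)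
  also have "\<dots> < \<infinity>"
    using fin emeasure_lborel_ball_finite[of x0 r] by (auto simp: ennreal_mult_less_top)
  finally have Fr: "F = ennreal (enn2real F)" by (simp add: less_top)
  have "ennreal (c0 / ?b) * F = ennreal (c0 / ?b * enn2real F)"
    using b c0 by (subst Fr) (simp flip: ennreal_mult)
  then have "ennreal \<bar>c - m\<bar> \<le> ennreal (c0 / ?b * enn2real F)"
    using close unfolding F_def[symmetric] by simp
  moreover have "0 \<le> c0 / ?b * enn2real F" using b c0 by simp
  ultimately have "\<bar>c - m\<bar> \<le> c0 / ?b * enn2real F"
    by (metis ennreal_le_iff)
  then have "\<bar>c - m\<bar> powr p \<le> (c0 / ?b * enn2real F) powr p"
    using p by (intro powr_mono2) auto
  also have "\<dots> = c0 powr p / ?b powr p * enn2real F powr p"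
    using b c0 by (simp add: powr_mult powr_divide)
  finally have "\<bar>c - m\<bar> powr p * ?W \<le> c0 powr p / ?b powr p * enn2real F powr p * ?W"
    by (rule mult_right_mono) simp
  then have "ennreal (\<bar>c - m\<bar> powr p * ?W) \<le> ennreal (c0 powr p / ?b powr p) * ennreal (enn2real F powr p * ?W)"
    by (simp add: ennreal_leI mult.assoc flip: ennreal_mult)
  also have "\<dots> \<le> ennreal (c0 powr p / ?b powr p) * (ennreal (K * ?b powr p) * ?D)"
    using Fr r by (intro mult_left_mono Ap_average) (auto simp: F_def)
  also have "\<dots> = ennreal (c0 powr p * K) * ?D"
    using b K_nonneg by (simp add: mult.assoc[symmetric] flip: ennreal_mult)
  finally show "ennreal (\<bar>c - m\<bar> powr p * ?W) \<le> ennreal (c0 powr p * K) * ?D" .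
qed (use K_nonneg in auto)

end

section \<open>Borel representatives of Lebesgue measurable data\<close>

lemma nn_integral_lebesgue_on_eq:
  assumes [measurable]: "B \<in> sets borel" and "AE x in lborel. x \<in> B \<longrightarrow> f x = g x"
  shows "(\<integral>\<^sup>+x. f x \<partial>lebesgue_on B) = (\<integral>\<^sup>+x\<in>B. g x \<partial>lborel)"
proof -
  have "(\<integral>\<^sup>+x. f x \<partial>lebesgue_on B) = (\<integral>\<^sup>+x\<in>B. f x \<partial>lborel)"
    by (subst nn_integral_restrict_space) (auto simp: nn_integral_completion)
  also have "\<dots> = (\<integral>\<^sup>+x\<in>B. g x \<partial>lborel)"
    using assms(2) by (intro nn_integral_cong_AE, eventually_elim) (auto split: split_indicator)
  finally show ?thesis .
qed

lemma integral_lebesgue_on_eq: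
  fixes f g :: "'a::euclidean_space \<Rightarrow> real"
  assumes [measurable]: "B \<in> sets borel" "g \<in> borel_measurable borel"
    and f: "f \<in> borel_measurable (lebesgue_on B)"
    and eq: "AE x in lborel. x \<in> B \<longrightarrow> f x = g x"
  shows "(\<integral>x. f x \<partial>lebesgue_on B) = (\<integral>x. g x * indicator B x \<partial>lborel)"
proof -
  have "(\<integral>x. f x \<partial>lebesgue_on B) = (\<integral>x. indicator B x *\<^sub>R f x \<partial>lebesgue)"
    by (rule integral_restrict_space) simp
  also have "\<dots> = (\<integral>x. g x * indicator B x \<partial>lebesgue)"
  proof (rule integral_cong_AE)
    show "(\<lambda>x. indicator B x *\<^sub>R f x) \<in> borel_measurable lebesgue"
      using f by (subst (asm) borel_measurable_restrict_space_iff) auto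
    show "(\<lambda>x. g x * indicator B x) \<in> borel_measurable lebesgue"
      by (rule measurable_completion) measurable
    show "AE x in lebesgue. indicator B x *\<^sub>R f x = g x * indicator B x"
      unfolding AE_completion_iff using eq by eventually_elim (auto split: split_indicator)
  qed
  also have "\<dots> = (\<integral>x. g x * indicator B x \<partial>lborel)"
    by (rule integral_completion) measurable
  finally show ?thesis .
qed

text \<open>Local integrability makes \<open>w\<close> measurable on each of countably many balls covering the space.
  Changing a Borel representative to \<open>1\<close> where it is not positive affects only a null set.\<close>

lemma weight_borel_representative:
  fixes w :: "real ^ 'n::finite \<Rightarrow> real"
  assumes "weight w"
  obtains w' where "w' \<in> borel_measurable borel" "\<And>x. 0 < w' x" "AE x in lborel. w x = w' x"
    "w \<in> borel_measurable lebesgue"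
proof -
  have "w \<in> borel_measurable lebesgue"
  proof (rule measurable_piecewise_restrict)
    show "countable (range (\<lambda>k::nat. cball (0 :: real ^ 'n) (real k)))" by simp
    show "space lebesgue \<subseteq> \<Union> (range (\<lambda>k::nat. cball (0 :: real ^ 'n) (real k)))"
      using real_arch_simple by (auto simp: dist_norm)
    fix \<Omega> assume \<Omega>: "\<Omega> \<in> range (\<lambda>k::nat. cball (0 :: real ^ 'n) (real k))"
    then show "\<Omega> \<inter> space lebesgue \<in> sets lebesgue" by auto
    show "w \<in> borel_measurable (lebesgue_on \<Omega>)"
      using assms \<Omega> by (auto simp: weight_def intro!: borel_measurable_integrable)
  qed
  note meas = this
  obtain u where u: "u \<in> borel_measurable lborel" "AE x in lborel. w x = u x"
    using completion_ex_borel_measurable_real[OF meas] by auto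
  define w' where "w' x = (if 0 < u x then u x else 1)" for x
  have [measurable]: "u \<in> borel_measurable borel" using u by simp
  show ?thesis
  proof
    show "w' \<in> borel_measurable borel" unfolding w'_def by measurable
    show "0 < w' x" for x by (simp add: w'_def)
    have "AE x in lborel. 0 < w x" using assms by (simp add: weight_def AE_completion_iff)
    with u(2) show "AE x in lborel. w x = w' x" by eventually_elim (simp add: w'_def)
  qed (rule meas)
qed

lemma Lp_borel_representative:
  fixes v :: "real ^ 'n::finite \<Rightarrow> real"
  assumes "v \<in> Lp_space p (ball x0 r)" "1 < p"
  obtains v' where "v' \<in> borel_measurable borel" "AE x in lborel. x \<in> ball x0 r \<longrightarrow> v x = v' x"
    "(\<integral>\<^sup>+x\<in>ball x0 r. ennreal \<bar>v' x\<bar> \<partial>lborel) < \<infinity>"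
proof -
  let ?B = "ball x0 r"
  have v: "v \<in> borel_measurable (lebesgue_on ?B)" "integrable (lebesgue_on ?B) (\<lambda>x. \<bar>v x\<bar> powr p)"
    using assms by (auto simp: Lp_space_def)
  then have "(\<lambda>x. indicator ?B x *\<^sub>R v x) \<in> borel_measurable lebesgue"
    by (subst (asm) borel_measurable_restrict_space_iff) auto
  then obtain v' where v': "v' \<in> borel_measurable lborel" "AE x in lborel. indicator ?B x *\<^sub>R v x = v' x"
    using completion_ex_borel_measurable_real by blast
  have [measurable]: "v' \<in> borel_measurable borel" using v' by simp
  have eq: "AE x in lborel. x \<in> ball x0 r \<longrightarrow> v x = v' x"
    using v'(2) by eventually_elim auto
  have "(\<integral>\<^sup>+x\<in>?B. ennreal \<bar>v' x\<bar> \<partial>lborel) \<le> (\<integral>\<^sup>+x. indicator ?B x + ennreal (\<bar>v' x\<bar> powr p) * indicator ?B x \<partial>lborel)"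
  proof (rule nn_integral_mono)
    fix x
    have "ennreal \<bar>v' x\<bar> \<le> ennreal (1 + \<bar>v' x\<bar> powr p)"
      by (intro ennreal_leI abs_le_one_plus_powr assms(2))
    then show "ennreal \<bar>v' x\<bar> * indicator ?B x \<le> indicator ?B x + ennreal (\<bar>v' x\<bar> powr p) * indicator ?B x"
      by (auto split: split_indicator)
  qed
  also have "\<dots> = emeasure lborel ?B + (\<integral>\<^sup>+x\<in>?B. ennreal (\<bar>v' x\<bar> powr p) \<partial>lborel)"
    by (subst nn_integral_add) auto
  also have "(\<integral>\<^sup>+x\<in>?B. ennreal (\<bar>v' x\<bar> powr p) \<partial>lborel) = (\<integral>\<^sup>+x. ennreal (\<bar>v x\<bar> powr p) \<partial>lebesgue_on ?B)"
    using eq by (intro nn_integral_lebesgue_on_eq[symmetric]) (auto elim: AE_mp)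
  also have "emeasure lborel ?B + \<dots> < \<infinity>"
    using v(2) emeasure_lborel_ball_finite[of x0 r] by (auto simp: integrable_iff_bounded less_top)
  finally show ?thesis using that[of v'] eq by simp
qed

text \<open>Since the mean of \<open>w\<close> over a ball is positive, a finite \<open>A\<^sub>p\<close> constant forces the dual
  weight to be integrable; after that both averages are real numbers and the extended inequality
  becomes the real one.\<close>

lemma Ap_class_locale:
  fixes w w' :: "real ^ 'n::finite \<Rightarrow> real"
  assumes w: "w \<in> Ap_class p" and p: "1 < p"
    and w': "w' \<in> borel_measurable borel" "\<And>x. 0 < w' x" and eq: "AE x in lborel. w x = w' x"
  shows "Ap_weight w' p (enn2real (Ap_const p w))"
proof -
  have [measurable]: "w' \<in> borel_measurable borel" by (rule w'(1))
  have emeas: "emeasure (weighted w') (ball z \<rho>) = (\<integral>\<^sup>+x\<in>ball z \<rho>. ennreal (w' x) \<partial>lborel)" for z \<rho>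
    unfolding weighted_def by (subst emeasure_density) auto
  have avg: "nn_average (ball z \<rho>) w = emeasure (weighted w') (ball z \<rho>) / ennreal (measure lborel (ball z \<rho>))" for z \<rho>
  proof -
    have "(\<integral>\<^sup>+x. ennreal (w x) \<partial>lebesgue_on (ball z \<rho>)) = emeasure (weighted w') (ball z \<rho>)"
      unfolding emeas using eq by (intro nn_integral_lebesgue_on_eq) auto
    then show ?thesis
      using emeasure_lborel_ball_finite[of z \<rho>] by (simp add: nn_average_def emeasure_eq_ennreal_measure less_top)
  qed
  let ?S = "\<lambda>z \<rho>. (\<integral>\<^sup>+x\<in>ball z \<rho>. ennreal (w' x powr (1 / (1 - p))) \<partial>lborel)"
  have avg': "nn_average (ball z \<rho>) (\<lambda>x. w x powr (1 / (1 - p))) = ?S z \<rho> / ennreal (measure lborel (ball z \<rho>))" for z \<rho>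
  proof -
    have "(\<integral>\<^sup>+x. ennreal (w x powr (1 / (1 - p))) \<partial>lebesgue_on (ball z \<rho>)) = ?S z \<rho>"
      using eq by (intro nn_integral_lebesgue_on_eq) (auto elim: AE_mp)
    then show ?thesis
      using emeasure_lborel_ball_finite[of z \<rho>] by (simp add: nn_average_def emeasure_eq_ennreal_measure less_top)
  qed
  have fin: "emeasure (weighted w') (ball z \<rho>) < \<infinity>" for z \<rho>
  proof -
    have "integrable (lebesgue_on (cball z \<rho>)) w"
      using w by (simp add: Ap_class_def weight_def)
    then have "(\<integral>\<^sup>+x. ennreal \<bar>w x\<bar> \<partial>lebesgue_on (cball z \<rho>)) < \<infinity>"
      by (simp add: integrable_iff_bounded)
    also have "(\<integral>\<^sup>+x. ennreal \<bar>w x\<bar> \<partial>lebesgue_on (cball z \<rho>)) = (\<integral>\<^sup>+x\<in>cball z \<rho>. ennreal (w' x) \<partial>lborel)"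
      using eq w'(2)[THEN less_imp_le] by (intro nn_integral_lebesgue_on_eq) (auto elim: AE_mp)
    finally have "(\<integral>\<^sup>+x\<in>cball z \<rho>. ennreal (w' x) \<partial>lborel) < \<infinity>" .
    then show ?thesis
      unfolding emeas by (rule le_less_trans[rotated]) (auto intro!: nn_integral_mono split: split_indicator)
  qed
  have Ap: "?S z \<rho> < \<infinity> \<and> measure (weighted w') (ball z \<rho>) * enn2real (?S z \<rho>) powr (p - 1)
      \<le> enn2real (Ap_const p w) * measure lborel (ball z \<rho>) powr p" if "0 < \<rho>" for z \<rho>
  proof -
    let ?b = "measure lborel (ball z \<rho>)"
    let ?W = "measure (weighted w') (ball z \<rho>)"
    have b: "0 < ?b" using that by (rule content_ball_pos)
    have W: "emeasure (weighted w') (ball z \<rho>) = ennreal ?W"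
      using fin[of z \<rho>] by (intro emeasure_eq_ennreal_measure) auto
    have "0 < emeasure (weighted w') (ball z \<rho>)"
      unfolding emeas using w' that by (intro nn_integral_positive) auto
    then have Wpos: "0 < ?W" unfolding W by simp
    have Kfin: "Ap_const p w < \<infinity>" using w by (simp add: Ap_class_def)
    have "nn_average (ball z \<rho>) w * ennreal_powr (nn_average (ball z \<rho>) (\<lambda>x. w x powr (1 / (1 - p)))) (p - 1) \<le> Ap_const p w"
      unfolding Ap_const_def using that by (intro SUP_upper2[of "(z, \<rho>)"]) auto
    then have le: "ennreal (?W / ?b) * ennreal_powr (?S z \<rho> / ennreal ?b) (p - 1) \<le> Ap_const p w"
      using b Wpos by (simp add: avg avg' W divide_ennreal)
    have Sfin: "?S z \<rho> < \<infinity>"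
    proof (rule ccontr)
      assume "\<not> ?thesis"
      then have "?S z \<rho> / ennreal ?b = \<infinity>" by (simp add: ennreal_top_divide less_top[symmetric])
      then have "ennreal (?W / ?b) * \<infinity> \<le> Ap_const p w"
        using le by (simp add: ennreal_powr_def)
      moreover have "ennreal (?W / ?b) * \<infinity> = \<infinity>"
        using Wpos b by (simp add: ennreal_mult_top)
      ultimately show False using Kfin by (simp add: top_unique)
    qed
    then have S: "?S z \<rho> = ennreal (enn2real (?S z \<rho>))" by (simp add: less_top)
    have "?S z \<rho> / ennreal ?b = ennreal (enn2real (?S z \<rho>) / ?b)"
      using b by (subst S) (simp add: divide_ennreal)
    then have "ennreal (?W / ?b * (enn2real (?S z \<rho>) / ?b) powr (p - 1)) \<le> ennreal (enn2real (Ap_const p w))"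
      using le Kfin b Wpos by (simp add: ennreal_powr_def less_top flip: ennreal_mult)
    then have "?W / ?b * (enn2real (?S z \<rho>) / ?b) powr (p - 1) \<le> enn2real (Ap_const p w)"
      by (subst (asm) ennreal_le_iff) auto
    then have "?W / ?b * (enn2real (?S z \<rho>) / ?b) powr (p - 1) * ?b powr p \<le> enn2real (Ap_const p w) * ?b powr p"
      by (rule mult_right_mono) auto
    also have "?W / ?b * (enn2real (?S z \<rho>) / ?b) powr (p - 1) * ?b powr p = ?W * enn2real (?S z \<rho>) powr (p - 1)"
      using b by (simp add: powr_divide powr_diff)
    finally show ?thesis using Sfin by simp
  qed
  show ?thesis
  proof
    show "?S z \<rho> < \<infinity>" for z \<rho>
      using Ap[of \<rho> z] by (cases "0 < \<rho>") (auto simp: ball_empty)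
  qed (use w' p fin Ap in auto)
qed

lemma weight_measure_ball_eq:
  fixes w w' :: "real ^ 'n::finite \<Rightarrow> real"
  assumes w: "w \<in> borel_measurable lebesgue"
    and [measurable]: "w' \<in> borel_measurable borel" and w': "\<And>x. 0 < w' x" and eq: "AE x in lborel. w x = w' x"
  shows "weight_measure w (ball z \<rho>) = measure (weighted w') (ball z \<rho>)"
proof -
  have "weight_measure w (ball z \<rho>) = (\<integral>x. w' x * indicator (ball z \<rho>) x \<partial>lborel)"
    unfolding weight_measure_def
    using eq w by (intro integral_lebesgue_on_eq) (auto elim: AE_mp intro: measurable_restrict_space1)
  also have "\<dots> = measure (weighted w') (ball z \<rho>)"
    using w'[THEN less_imp_le] unfolding measure_def weighted_def
    by (subst integral_eq_nn_integral, auto simp: emeasure_density ennreal_mult ennreal_indicator)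
  finally show ?thesis .
qed

lemma weighted_deviation_eq:
  fixes w w' v v' :: "real ^ 'n::finite \<Rightarrow> real"
  assumes [measurable]: "w' \<in> borel_measurable borel" "v' \<in> borel_measurable borel"
    and w': "\<And>x. 0 < w' x" and eq: "AE x in lborel. w x = w' x"
    and eqv: "AE x in lborel. x \<in> ball x0 r \<longrightarrow> v x = v' x"
  shows "weighted_deviation p w (ball x0 r) v m
    = (\<integral>\<^sup>+x\<in>ball x0 r. ennreal (\<bar>v' x - m\<bar> powr p) \<partial>weighted w')"
proof -
  have "AE x in lborel. x \<in> ball x0 r \<longrightarrow> ennreal (\<bar>v x - m\<bar> powr p * w x) = ennreal (w' x) * ennreal (\<bar>v' x - m\<bar> powr p)"
    using eq eqv by eventually_elim (auto simp: ennreal_mult w'[THEN less_imp_le] mult.commute)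
  then have "weighted_deviation p w (ball x0 r) v m = (\<integral>\<^sup>+x\<in>ball x0 r. ennreal (w' x) * ennreal (\<bar>v' x - m\<bar> powr p) \<partial>lborel)"
    unfolding weighted_deviation_def by (intro nn_integral_lebesgue_on_eq) auto
  also have "\<dots> = (\<integral>\<^sup>+x\<in>ball x0 r. ennreal (\<bar>v' x - m\<bar> powr p) \<partial>weighted w')"
    unfolding weighted_def by (subst nn_integral_density) (auto simp: mult.assoc)
  finally show ?thesis .
qed

lemma gagliardo_eq:
  fixes w w' v v' :: "real ^ 'n::finite \<Rightarrow> real"
  assumes A: "Ap_weight w' p K"
    and w: "w \<in> borel_measurable lebesgue" and eq: "AE x in lborel. w x = w' x"
    and eqv: "AE x in lborel. x \<in> ball x0 r \<longrightarrow> v x = v' x"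
  shows "gagliardo s p w (ball x0 r) v = Ap_weight.gagliardo_energy w' p s (ball x0 r) v'"
proof -
  interpret Ap_weight w' p K by (rule A)
  let ?B = "ball x0 r"
  let ?k = "\<lambda>x y. ennreal (gagliardo_kernel v' y x / norm (y - x) powr (s * p))"
  have wm: "weight_measure w (ball_between x y) = measure \<mu> (ball ((1 / 2) *\<^sub>R (y + x)) (norm (y - x) / 2))" for x y
    unfolding ball_between_def using w eq w_pos
    by (simp add: weight_measure_ball_eq add.commute norm_minus_commute)
  have "(\<integral>\<^sup>+x. ennreal (\<bar>v x - v y\<bar> powr p / norm (x - y) powr (s * p) * (w x * w y / weight_measure w (ball_between x y))) \<partial>lebesgue_on ?B)
      = (\<integral>\<^sup>+x\<in>?B. ?k x y \<partial>lborel)" if "v y = v' y" "w y = w' y" for y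
  proof (rule nn_integral_lebesgue_on_eq)
    show "AE x in lborel. x \<in> ?B \<longrightarrow> ennreal (\<bar>v x - v y\<bar> powr p / norm (x - y) powr (s * p) * (w x * w y / weight_measure w (ball_between x y))) = ?k x y"
      using eq eqv by eventually_elim
        (auto simp: that wm gagliardo_kernel_def abs_minus_commute norm_minus_commute mult_ac)
  qed simp
  note inner = this
  have "gagliardo s p w ?B v = (\<integral>\<^sup>+y\<in>?B. (\<integral>\<^sup>+x\<in>?B. ?k x y \<partial>lborel) \<partial>lborel)"
    unfolding gagliardo_def
  proof (rule nn_integral_lebesgue_on_eq)
    show "AE y in lborel. y \<in> ?B \<longrightarrow>
        (\<integral>\<^sup>+x. ennreal (\<bar>v x - v y\<bar> powr p / norm (x - y) powr (s * p) * (w x * w y / weight_measure w (ball_between x y))) \<partial>lebesgue_on ?B)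
        = (\<integral>\<^sup>+x\<in>?B. ?k x y \<partial>lborel)"
      using eq eqv by eventually_elim (use inner in blast)
  qed simp
  also have "\<dots> = gagliardo_energy s ?B v'"
    unfolding gagliardo_energy_def
    by (intro nn_integral_cong) (auto split: split_indicator intro!: nn_integral_cong)
  finally show ?thesis .
qed

text \<open>As \<open>\<psi>\<close> has integral \<open>1\<close>, \<open>c - m\<close> is the integral of \<open>(c - v) \<psi>\<close>. The product \<open>v \<psi>\<close> is
  integrable because \<open>\<psi>\<close> is essentially bounded.\<close>

lemma bounded_mean_close:
  fixes v v' \<psi> :: "real ^ 'n::finite \<Rightarrow> real"
  assumes [measurable]: "v' \<in> borel_measurable borel"
    and v: "integrable (lebesgue_on (ball x0 r)) v" and eqv: "AE x in lborel. x \<in> ball x0 r \<longrightarrow> v x = v' x"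
    and r: "0 < r" and c0: "0 < c0" and psi: "\<psi> \<in> Linf_space (ball x0 r)"
    and psi_1: "integral\<^sup>L (lebesgue_on (ball x0 r)) \<psi> = 1"
    and psi_le: "Linf_norm (ball x0 r) \<psi> \<le> ereal (c0 / measure lebesgue (ball x0 r))"
  shows "ennreal \<bar>c - psi_mean (ball x0 r) \<psi> v\<bar>
     \<le> ennreal (c0 / measure lborel (ball x0 r)) * (\<integral>\<^sup>+x\<in>ball x0 r. ennreal \<bar>v' x - c\<bar> \<partial>lborel)"
proof -
  let ?B = "ball x0 r" and ?q = "c0 / measure lborel (ball x0 r)"
  let ?M = "lebesgue_on (ball x0 r)"
  have q: "0 \<le> ?q" using c0 by simp
  have psi_meas [measurable]: "\<psi> \<in> borel_measurable ?M" using psi by (simp add: Linf_space_def)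
  have psi_bound: "AE x in ?M. \<bar>\<psi> x\<bar> \<le> ?q"
    using esssup_AE[of "\<lambda>x. ereal \<bar>\<psi> x\<bar>" ?M]
  proof eventually_elim
    case (elim x)
    then have "ereal \<bar>\<psi> x\<bar> \<le> ereal (c0 / measure lebesgue ?B)"
      using psi_le unfolding Linf_norm_def by (rule order_trans)
    then show ?case by simp
  qed
  have psi_int: "integrable ?M \<psi>" using psi_1 not_integrable_integral_eq by fastforce
  have [measurable]: "v \<in> borel_measurable ?M" using v by simp
  have vpsi_int: "integrable ?M (\<lambda>x. v x * \<psi> x)"
  proof (rule Bochner_Integration.integrable_bound)
    show "integrable ?M (\<lambda>x. ?q * v x)" using v by simp
    show "AE x in ?M. norm (v x * \<psi> x) \<le> norm (?q * v x)"
      using psi_bound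
    proof eventually_elim
      case (elim x)
      then have "\<bar>\<psi> x\<bar> * \<bar>v x\<bar> \<le> ?q * \<bar>v x\<bar>" by (intro mult_right_mono) auto
      then show ?case using c0 by (simp add: abs_mult mult.commute)
    qed
  qed measurable
  have "c - psi_mean ?B \<psi> v = (\<integral>x. c * \<psi> x - v x * \<psi> x \<partial>?M)"
    using psi_int vpsi_int psi_1 by (simp add: psi_mean_def)
  then have "ennreal \<bar>c - psi_mean ?B \<psi> v\<bar> \<le> (\<integral>\<^sup>+x. ennreal (norm (c * \<psi> x - v x * \<psi> x)) \<partial>?M)"
    using integral_norm_bound_ennreal[of ?M "\<lambda>x. c * \<psi> x - v x * \<psi> x"] psi_int vpsi_int by simp
  also have "\<dots> \<le> (\<integral>\<^sup>+x. ennreal ?q * ennreal \<bar>v x - c\<bar> \<partial>?M)"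
  proof (rule nn_integral_mono_AE)
    show "AE x in ?M. ennreal (norm (c * \<psi> x - v x * \<psi> x)) \<le> ennreal ?q * ennreal \<bar>v x - c\<bar>"
      using psi_bound
    proof eventually_elim
      case (elim x)
      have "norm (c * \<psi> x - v x * \<psi> x) = \<bar>v x - c\<bar> * \<bar>\<psi> x\<bar>"
        by (simp add: abs_minus_commute flip: left_diff_distrib abs_mult)
      also have "\<dots> \<le> \<bar>v x - c\<bar> * ?q" using elim by (intro mult_left_mono) auto
      finally show ?case using q by (simp add: ennreal_leI mult.commute flip: ennreal_mult)
    qed
  qed
  also have "\<dots> = (\<integral>\<^sup>+x\<in>?B. ennreal ?q * ennreal \<bar>v' x - c\<bar> \<partial>lborel)"
    using eqv by (intro nn_integral_lebesgue_on_eq) (auto elim!: AE_mp)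
  also have "\<dots> = ennreal ?q * (\<integral>\<^sup>+x\<in>?B. ennreal \<bar>v' x - c\<bar> \<partial>lborel)"
    by (subst nn_integral_cmult[symmetric]) (auto simp: mult.assoc)
  finally show ?thesis .
qed

section \<open>The weighted fractional Poincare inequality\<close>

lemma poincare_const_nonneg: "0 \<le> p \<Longrightarrow> 0 \<le> K \<Longrightarrow> 0 \<le> poincare_const n p K"
  by (simp add: poincare_const_def scale_const_def)

text \<open>The passage to Borel representatives carries the results for the locale over to a weight in
  \<open>A\<^sub>p\<close>, its \<open>A\<^sub>p\<close> constant and a function in the fractional Sobolev space.\<close>

lemma fractional_poincare_Ap:
  fixes w v :: "real ^ 'n::finite \<Rightarrow> real"
  assumes s: "0 < s" "s < 1" and p: "1 < p" and w: "w \<in> Ap_class p" and r: "0 < r"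
    and v: "v \<in> frac_sobolev s p w (ball x0 r)"
  defines "K \<equiv> enn2real (Ap_const p w)"
  defines "E \<equiv> ennreal (poincare_const CARD('n) p K * (1 - s) * r powr (s * p)) * gagliardo s p w (ball x0 r) v"
  shows "weighted_deviation p w (ball x0 r) v (mean (ball x0 r) v) \<le> E"
    and "weighted_deviation p w (ball x0 r) v
           (psi_mean (ball x0 r) (\<lambda>x. w x / weight_measure w (ball x0 r)) v) \<le> ennreal (2 powr p) * E"
    and "0 < c0 \<Longrightarrow> \<psi> \<in> Linf_space (ball x0 r) \<Longrightarrow> integral\<^sup>L (lebesgue_on (ball x0 r)) \<psi> = 1 \<Longrightarrow>
         Linf_norm (ball x0 r) \<psi> \<le> ereal (c0 / measure lebesgue (ball x0 r)) \<Longrightarrow>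
         weighted_deviation p w (ball x0 r) v (psi_mean (ball x0 r) \<psi> v)
           \<le> ennreal (2 powr (p - 1) * (1 + c0 powr p * K)) * E"
proof -
  let ?B = "ball x0 r"
  obtain w' where w': "w' \<in> borel_measurable borel" "\<And>x. 0 < w' x" "AE x in lborel. w x = w' x"
    and w_meas: "w \<in> borel_measurable lebesgue"
    using weight_borel_representative[of w] w by (auto simp: Ap_class_def)
  interpret Ap_weight w' p K unfolding K_def by (rule Ap_class_locale[OF w p w'])
  have vLp: "v \<in> Lp_space p ?B" and gfin: "gagliardo s p w ?B v < \<infinity>"
    using v by (auto simp: frac_sobolev_def)
  obtain v' where v' [measurable]: "v' \<in> borel_measurable borel"
    and eqv: "AE x in lborel. x \<in> ?B \<longrightarrow> v x = v' x"
    and fin: "(\<integral>\<^sup>+x\<in>?B. ennreal \<bar>v' x\<bar> \<partial>lborel) < \<infinity>"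
    using Lp_borel_representative[OF vLp p] by blast
  have v_meas: "v \<in> borel_measurable (lebesgue_on ?B)" using vLp by (simp add: Lp_space_def)
  have w_meas': "w \<in> borel_measurable (lebesgue_on ?B)" using w_meas by (rule measurable_restrict_space1)
  define c where "c = (\<integral>y. v' y * indicator ?B y \<partial>lborel) / measure lborel ?B"
  define D where "D = (\<integral>\<^sup>+x\<in>?B. ennreal (\<bar>v' x - c\<bar> powr p) \<partial>\<mu>)"
  have dev: "weighted_deviation p w ?B v m = (\<integral>\<^sup>+x\<in>?B. ennreal (\<bar>v' x - m\<bar> powr p) \<partial>\<mu>)" for m
    by (rule weighted_deviation_eq[OF w'(1) v' w'(2,3) eqv])
  have mean: "mean ?B v = c"
    unfolding mean_def c_def by (subst integral_lebesgue_on_eq[OF _ v' v_meas eqv]) auto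
  have D_le: "D \<le> E"
    unfolding D_def E_def gagliardo_eq[OF Ap_weight_axioms w_meas w'(3) eqv]
    using fractional_poincare[OF v' fin r s c_def] by simp
  show "weighted_deviation p w ?B v (mean ?B v) \<le> E"
    using D_le by (simp add: dev mean D_def)
  have "E < \<infinity>" using gfin by (simp add: E_def ennreal_mult_less_top)
  then have Dfin: "D < \<infinity>" using D_le by simp
  have wm: "weight_measure w ?B = measure \<mu> ?B"
    by (rule weight_measure_ball_eq[OF w_meas w'])
  have "psi_mean ?B (\<lambda>x. w x / weight_measure w ?B) v
      = (\<integral>x. v' x * (w' x / measure \<mu> ?B) * indicator ?B x \<partial>lborel)"
    unfolding psi_mean_def wm
  proof (rule integral_lebesgue_on_eq)
    show "AE x in lborel. x \<in> ?B \<longrightarrow> v x * (w x / measure \<mu> ?B) = v' x * (w' x / measure \<mu> ?B)"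
      using eqv w'(3) by eventually_elim auto
  qed (use v_meas w_meas' in auto)
  then have "weighted_deviation p w ?B v (psi_mean ?B (\<lambda>x. w x / weight_measure w ?B) v) \<le> ennreal (2 powr p) * D"
    unfolding dev D_def using Dfin by (intro deviation_weighted_mean r) (auto simp: D_def)
  also have "\<dots> \<le> ennreal (2 powr p) * E" by (intro mult_left_mono D_le) simp
  finally show "weighted_deviation p w ?B v (psi_mean ?B (\<lambda>x. w x / weight_measure w ?B) v) \<le> ennreal (2 powr p) * E" .
  show "weighted_deviation p w ?B v (psi_mean ?B \<psi> v) \<le> ennreal (2 powr (p - 1) * (1 + c0 powr p * K)) * E"
    if "0 < c0" "\<psi> \<in> Linf_space ?B" "integral\<^sup>L (lebesgue_on ?B) \<psi> = 1"
       "Linf_norm ?B \<psi> \<le> ereal (c0 / measure lebesgue ?B)"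
  proof -
    have "(\<integral>\<^sup>+x. ennreal (norm (v x)) \<partial>lebesgue_on ?B) = (\<integral>\<^sup>+x\<in>?B. ennreal \<bar>v' x\<bar> \<partial>lborel)"
      using eqv by (intro nn_integral_lebesgue_on_eq) (auto elim!: AE_mp)
    then have "integrable (lebesgue_on ?B) v"
      using fin v_meas by (intro integrableI_bounded) auto
    from bounded_mean_close[OF v' this eqv r that]
    have "weighted_deviation p w ?B v (psi_mean ?B \<psi> v) \<le> ennreal (2 powr (p - 1) * (1 + c0 powr p * K)) * D"
      unfolding dev D_def using that(1) by (intro deviation_bounded_mean r fin) auto
    also have "\<dots> \<le> ennreal (2 powr (p - 1) * (1 + c0 powr p * K)) * E"
      by (intro mult_left_mono D_le) simp
    finally show ?thesis .
  qed
qed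

theorem theorem2p10:
  assumes "2 \<le> CARD('n::finite)"
  shows "(\<exists>C :: real \<Rightarrow> real \<Rightarrow> real.
            continuous_on ({1<..} \<times> {1..}) (\<lambda>(p, K). C p K) \<and>
            (\<forall>s p (w :: real ^ 'n \<Rightarrow> real) x0 r v.
               0 < s \<and> s < 1 \<and> 1 < p \<and> w \<in> Ap_class p \<and> 0 < r \<and>
               v \<in> frac_sobolev s p w (ball x0 r) \<longrightarrow>
               weighted_deviation p w (ball x0 r) v (mean (ball x0 r) v)
                 \<le> ennreal (C p (enn2real (Ap_const p w)) * (1 - s) * r powr (s * p))
                    * gagliardo s p w (ball x0 r) v \<and>
               weighted_deviation p w (ball x0 r) v
                   (psi_mean (ball x0 r) (\<lambda>x. w x / weight_measure w (ball x0 r)) v)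
                 \<le> ennreal (C p (enn2real (Ap_const p w)) * (1 - s) * r powr (s * p))
                    * gagliardo s p w (ball x0 r) v)) \<and>
         (\<exists>C :: real \<Rightarrow> real \<Rightarrow> real \<Rightarrow> real.
            continuous_on ({1<..} \<times> {1..} \<times> {0<..}) (\<lambda>(p, K, c0). C p K c0) \<and>
            (\<forall>s p (w :: real ^ 'n \<Rightarrow> real) x0 r v c0 \<psi>.
               0 < s \<and> s < 1 \<and> 1 < p \<and> w \<in> Ap_class p \<and> 0 < r \<and>
               v \<in> frac_sobolev s p w (ball x0 r) \<and>
               0 < c0 \<and> \<psi> \<in> Linf_space (ball x0 r) \<and>
               integral\<^sup>L (lebesgue_on (ball x0 r)) \<psi> = 1 \<and>
               Linf_norm (ball x0 r) \<psi> \<le> ereal (c0 / measure lebesgue (ball x0 r)) \<longrightarrow>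
               weighted_deviation p w (ball x0 r) v (psi_mean (ball x0 r) \<psi> v)
                 \<le> ennreal (C p (enn2real (Ap_const p w)) c0 * (1 - s) * r powr (s * p))
                    * gagliardo s p w (ball x0 r) v))"
proof -
  let ?P = "poincare_const CARD('n)"
  have P_cont: "continuous_on S (\<lambda>q. ?P (f q) (g q))"
    if "continuous_on S f" "continuous_on S g" for S and f g :: "'z::topological_space \<Rightarrow> real"
    unfolding poincare_const_def scale_const_def using that by (intro continuous_intros) auto
  show ?thesis
  proof (intro conjI exI allI impI)
    show "continuous_on ({1<..} \<times> {1..}) (\<lambda>(p, K). 2 powr p * ?P p K)"
      unfolding case_prod_unfold by (intro continuous_intros P_cont) auto
    show "continuous_on ({1<..} \<times> {1..} \<times> {0<..})
        (\<lambda>(p, K, c0). 2 powr (p - 1) * (1 + c0 powr p * K) * ?P p K)"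
      unfolding case_prod_unfold by (intro continuous_intros P_cont) auto
  next
    fix s p :: real and w :: "real ^ 'n \<Rightarrow> real" and x0 r v
    assume *: "0 < s \<and> s < 1 \<and> 1 < p \<and> w \<in> Ap_class p \<and> 0 < r \<and> v \<in> frac_sobolev s p w (ball x0 r)"
    let ?K = "enn2real (Ap_const p w)"
    let ?G = "gagliardo s p w (ball x0 r) v"
    let ?E = "ennreal (?P p ?K * (1 - s) * r powr (s * p)) * ?G"
    have nonneg: "0 \<le> ?P p ?K * (1 - s) * r powr (s * p)"
      using * by (intro mult_nonneg_nonneg poincare_const_nonneg) auto
    have E: "ennreal (2 powr p) * ?E = ennreal (2 powr p * ?P p ?K * (1 - s) * r powr (s * p)) * ?G"
      using nonneg by (simp add: mult.assoc[symmetric] flip: ennreal_mult)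
    \<comment> \<open>The factor \<open>2\<close> to the power \<open>p\<close> is only lost for the weighted mean, but one constant has to
      serve both means.\<close>
    have "weighted_deviation p w (ball x0 r) v (mean (ball x0 r) v) \<le> ennreal 1 * ?E"
      using fractional_poincare_Ap(1)[of s p w r v x0] * by simp
    also have "\<dots> \<le> ennreal (2 powr p) * ?E"
      using * by (intro mult_right_mono ennreal_leI) (auto intro!: ge_one_powr_ge_zero)
    finally show "weighted_deviation p w (ball x0 r) v (mean (ball x0 r) v)
        \<le> ennreal (2 powr p * ?P p ?K * (1 - s) * r powr (s * p)) * ?G"
      unfolding E .
    show "weighted_deviation p w (ball x0 r) v
          (psi_mean (ball x0 r) (\<lambda>x. w x / weight_measure w (ball x0 r)) v)
        \<le> ennreal (2 powr p * ?P p ?K * (1 - s) * r powr (s * p)) * ?G"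
      unfolding E[symmetric] using fractional_poincare_Ap(2)[of s p w r v x0] * by simp
  next
    fix s p :: real and w :: "real ^ 'n \<Rightarrow> real" and x0 r v c0 \<psi>
    assume *: "0 < s \<and> s < 1 \<and> 1 < p \<and> w \<in> Ap_class p \<and> 0 < r \<and>
      v \<in> frac_sobolev s p w (ball x0 r) \<and> 0 < c0 \<and> \<psi> \<in> Linf_space (ball x0 r) \<and>
      integral\<^sup>L (lebesgue_on (ball x0 r)) \<psi> = 1 \<and>
      Linf_norm (ball x0 r) \<psi> \<le> ereal (c0 / measure lebesgue (ball x0 r))"
    let ?K = "enn2real (Ap_const p w)"
    let ?G = "gagliardo s p w (ball x0 r) v"
    let ?E = "ennreal (?P p ?K * (1 - s) * r powr (s * p)) * ?G"
    let ?A = "2 powr (p - 1) * (1 + c0 powr p * ?K)"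
    have nonneg: "0 \<le> ?P p ?K * (1 - s) * r powr (s * p)"
      using * by (intro mult_nonneg_nonneg poincare_const_nonneg) auto
    have E: "ennreal ?A * ?E = ennreal (?A * ?P p ?K * (1 - s) * r powr (s * p)) * ?G"
      using nonneg by (simp add: mult.assoc[symmetric] flip: ennreal_mult)
    show "weighted_deviation p w (ball x0 r) v (psi_mean (ball x0 r) \<psi> v)
        \<le> ennreal (?A * ?P p ?K * (1 - s) * r powr (s * p)) * ?G"
      unfolding E[symmetric] using fractional_poincare_Ap(3)[of s p w r v x0 c0 \<psi>] * by simp
  qed
qed

end
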